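(* Let $n\ge1$. There exist a numerical constant $c>0$ (independent of $n$ and of the weight), a numerical constant $C>0$, and a constant $C_n>0$ depending only on $n$, such that the following hold. (1) For every strong Muckenhoupt weight $w\in A_\infty^*$ on $\mathbb R^n$, every rectangular parallelepiped $R\subseteq\mathbb R^n$ with sides parallel to the coordinate axes, and every $r$ with $1<r<1+\frac1{cn[w]_{A_\infty^*}-1}$, $$\Bigl(\frac1{|R|}\int_R w^r\Bigr)^{1/r}\le \frac{C_n}{\bigl(1-(r-1)(cn[w]_{A_\infty^*}-1)\bigr)^{1/r}}\;\frac1{|R|}\int_R w .$$ (2) (Optimality) If $r>1$, $B\ge1$ and $w$ is a weight on $\mathbb R^n$ satisfying $$\Bigl(\frac1{|R|}\int_R w^r\Bigr)^{1/r}\le B\,\frac1{|R|}\int_R w$$ for all rectangular parallelepipeds $R\subseteq\mathbb R^n$ with sides parallel to the coordinate axes, then $w\in A_\infty^*$ and $[w]_{A_\infty^*}\le C\,r'(1+\ln B)$, where $1/r+1/r'=1$.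
   Context: A weight on $\mathbb R^n$ is a non-negative locally integrable function; $w(E)=\int_E w(x)\,dx$. For a weight $v$ on $\mathbb R$, the Fujii–Wilson constant is $[v]_{A_\infty}=\sup_I\frac1{v(I)}\int_I\mathsf M_1(v\mathbf 1_I)$, the supremum over bounded intervals $I\subset\mathbb R$, where $\mathsf M_1f(x)=\sup_{I\ni x}\frac1{|I|}\int_I|f|$ is the non-centered Hardy–Littlewood maximal operator on $\mathbb R$. For a weight $w$ on $\mathbb R^n$, $1\le j\le n$ and $\bar x^j=(x_1,\dots,x_{j-1},x_{j+1},\dots,x_n)\in\mathbb R^{n-1}$, let $w_{\bar x^j}(t)=w(x_1,\dots,x_{j-1},t,x_{j+1},\dots,x_n)$, $t\in\mathbb R$. Define $[w]_{A_\infty^*}=\sup_{1\le j\le n}\operatorname{ess\,sup}_{\bar x^j\in\mathbb R^{n-1}}[w_{\bar x^j}]_{A_\infty}$. The class $A_\infty^*$ of strong Muckenhoupt weights consists of the weights $w$ with $[w]_{A_\infty^*}<+\infty$. *)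

theory Defs
  imports "HOL-Analysis.Analysis" "HOL-Probability.Essential_Supremum"
begin

(* For a finite index set I, the Euclidean space R^I is the set of extensional functions
   PiE I (%_. UNIV), and leb I is Lebesgue measure on it (the product of lborel is only
   defined on Borel sets, hence the completion).  R^n is R^I for I = {1..n}; a point
   (x_1,..,x_{j-1},x_{j+1},..,x_n) of R^(n-1) is a point of R^I for I = {1..n} - {j}. *)
definition leb :: "nat set \<Rightarrow> (nat \<Rightarrow> real) measure" where
  "leb I = completion (Pi\<^sub>M I (\<lambda>_. lborel))"

(* Nondegenerate and closed; open or half-open ones differ from these by null sets only. *)
definition parallelepipeds :: "nat \<Rightarrow> (nat \<Rightarrow> real) set set" where
  "parallelepipeds n =
     {(\<Pi>\<^sub>E i\<in>{1..n}. {a i..b i}) | a b. \<forall>i\<in>{1..n}. a i < b i}"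

(* Every compact set is contained in a parallelepiped, so the second conjunct is local
   integrability (it includes Lebesgue measurability). *)
definition weight :: "nat \<Rightarrow> ((nat \<Rightarrow> real) \<Rightarrow> real) \<Rightarrow> bool" where
  "weight n w \<longleftrightarrow> (\<forall>x\<in>space (leb {1..n}). 0 \<le> w x) \<and>
     (\<forall>R\<in>parallelepipeds n. set_integrable (leb {1..n}) R w)"

definition maximal1 :: "(real \<Rightarrow> real) \<Rightarrow> real \<Rightarrow> ennreal" where
  "maximal1 f x = (SUP (a, b)\<in>{(a, b). a < b \<and> x \<in> {a..b}}.
     (\<integral>\<^sup>+t\<in>{a..b}. ennreal \<bar>f t\<bar> \<partial>lebesgue) / emeasure lebesgue {a..b})"

(* If v vanishes almost everywhere on an interval, the quotient there is 0 / 0 = 0. *)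
definition fujii_wilson :: "(real \<Rightarrow> real) \<Rightarrow> ennreal" where
  "fujii_wilson v = (SUP (a, b)\<in>{(a, b). a < b}.
     (\<integral>\<^sup>+x\<in>{a..b}. maximal1 (\<lambda>t. v t * indicator {a..b} t) x \<partial>lebesgue) /
     (\<integral>\<^sup>+x\<in>{a..b}. ennreal (v x) \<partial>lebesgue))"

(* The library's esssup is set to top on non-measurable functions by convention;
   on measurable functions the two agree. *)
definition ess_sup :: "'a measure \<Rightarrow> ('a \<Rightarrow> ennreal) \<Rightarrow> ennreal" where
  "ess_sup M f = Inf {z. AE x in M. f x \<le> z}"

lemma ess_sup_eq_esssup: "f \<in> borel_measurable M \<Longrightarrow> ess_sup M f = esssup M f"
  by (simp add: ess_sup_def esssup_eq_AE)

(* w (x(j := t)) is the value of w at (x_1,..,x_{j-1},t,x_{j+1},..,x_n). *)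
definition A_infty_star_const :: "nat \<Rightarrow> ((nat \<Rightarrow> real) \<Rightarrow> real) \<Rightarrow> ennreal" where
  "A_infty_star_const n w =
     (SUP j\<in>{1..n}. ess_sup (leb ({1..n} - {j})) (\<lambda>x. fujii_wilson (\<lambda>t. w (x(j := t)))))"

definition A_infty_star :: "nat \<Rightarrow> ((nat \<Rightarrow> real) \<Rightarrow> real) set" where
  "A_infty_star n = {w. weight n w \<and> A_infty_star_const n w < top}"

definition average :: "nat \<Rightarrow> (nat \<Rightarrow> real) set \<Rightarrow> ((nat \<Rightarrow> real) \<Rightarrow> real) \<Rightarrow> real" where
  "average n R f = 1 / measure (leb {1..n}) R * (LINT x:R|leb {1..n}. f x)"

(* The integrability conjunct says that the left-hand side is finite; without it a divergent
   integral of w^r would count as 0. *)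
definition reverse_hoelder ::
    "nat \<Rightarrow> real \<Rightarrow> real \<Rightarrow> ((nat \<Rightarrow> real) \<Rightarrow> real) \<Rightarrow> (nat \<Rightarrow> real) set \<Rightarrow> bool" where
  "reverse_hoelder n r K w R \<longleftrightarrow>
     set_integrable (leb {1..n}) R (\<lambda>x. w x powr r) \<and>
     average n R (\<lambda>x. w x powr r) powr (1 / r) \<le> K * average n R w"

end

theory Submission
  imports Defs
begin

text \<open>
  Both implications are statements about lines parallel to the axes.

  \<^emph>\<open>From lines to boxes.\<close> The heart is a reverse Hoelder inequality on an interval
  (\<open>reverse_hoelder_interval\<close>): if $[v]_{A_\infty} \le A$ with $A \ge 1$, then
  $\int_I v^r \le 6\,|I|^{1-r} (\int_I v)^r$ as soon as $20 A (r - 1) \le 1$. Let $u$ be the average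
  of $v$ over $I$, and let $O_k$ be the union of the maximal dyadic subintervals of $I$ on which the
  average of $v$ exceeds $2^k u$. Such an interval has average at most $2^{k+1} u$, because its
  parent was not selected, so $2^k u\,|O_k| \ge v(O_k) / 2$. The maximal function exceeds
  $2^k u$ on $O_k$; adding up the layers $k = 1, \dots, m$ gives
  $A\,v(I) \ge \int_I M (v 1_I) \ge (m / 4)\,v(O_m)$. Hence for $m \ge 8 A$ at most half of the
  mass of $I$ lies in $O_m$. Off $O_m$ the averages are at most $2^m u$, and on each interval of
  $O_m$, whose average is at most $2^{m+1} u$, the argument is repeated. Each round costs a factor
  $2^{(m+1)(r-1)} \le 3/2$ and halves the mass, so the resulting geometric series is bounded by an
  absolute constant. In the proof this is an induction on the number of dyadic generations
  (\<open>energy_bound\<close>), followed by Lebesgue differentiation and Fatou's lemma.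

  In several variables the inequality is applied to one coordinate after the other
  (\<open>reverse_hoelder_box\<close>). What makes this possible is that integrating a weight over one
  variable preserves the condition in all the others with the same $A$: the maximal function is
  sublinear, so the maximal function of an integral is at most the integral of the maximal
  functions. Every coordinate contributes a factor 6, so $C_n = 6^n$.

  The condition is used only through \<open>dyadic_max\<close>, the integral of the dyadic maximal function
  with boundedly many generations, written in terms of the masses of intervals. It is measurable in
  every parameter, its sublinearity is an induction, and it is dominated by the maximal function.

  \<^emph>\<open>From boxes to lines.\<close> Shrinking a box in all directions but one yields the reverse Hoelder
  inequality on almost every line. The shrinking is done one coordinate at a time by one-dimensional
  Lebesgue differentiation along dyadic intervals with rational end points, so that only countably
  many exceptional null sets occur (\<open>AE_le_of_rational_boxes\<close>). On a line, the weak type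
  $(1,1)$ bound for the maximal function, applied to the part of $v$ above each level $2^k u$, gives
  $\int_I M (v 1_I) \le 2 v(I) + 10 \int_I v\,N$, where $N$ is the number of $k \ge 0$ with
  $2^k u < v$. Now $N \le 1 + 2 \ln (v/u)$ where $v > u$, and
  $(r-1) \ln (v/u) \le \ln \beta + (v/u)^{r-1} / \beta$ with $\beta = B^r$. The integral
  of $v\,(v/u)^{r-1}$ is what the reverse Hoelder inequality controls, by $\beta\,v(I)$, and
  $B$ enters the result only through its logarithm (\<open>interval_maximal_integral_le\<close>).
\<close>

section \<open>Dyadic stopping intervals\<close>

abbreviation mid :: "real \<Rightarrow> real \<Rightarrow> real" where
  "mid c d \<equiv> (c + d) / 2"

text \<open>
  The integral over $(c,d]$ of the larger of \<open>s\<close> and the dyadic maximal function of \<open>V\<close> relative to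
  $(c,d]$, with \<open>N\<close> generations below $(c,d]$. The argument \<open>s\<close> carries the maximum of the averages
  over the ancestors down the recursion.
\<close>
primrec dyadic_max :: "nat \<Rightarrow> (real \<Rightarrow> real \<Rightarrow> ennreal) \<Rightarrow> ennreal \<Rightarrow> real \<Rightarrow> real \<Rightarrow> ennreal" where
  "dyadic_max 0 V s c d = max s (V c d / ennreal (d - c)) * ennreal (d - c)"
| "dyadic_max (Suc N) V s c d =
     dyadic_max N V (max s (V c d / ennreal (d - c))) c (mid c d) +
     dyadic_max N V (max s (V c d / ennreal (d - c))) (mid c d) d"

text \<open>
  The sum of \<open>G\<close> over the maximal dyadic subintervals of $(c,d]$, of generation at most \<open>N\<close>, on which
  the average of \<open>F\<close> exceeds \<open>l\<close>. With \<open>G = F\<close> it is the mass of their union, with \<open>G\<close> the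
  length it is its Lebesgue measure.
\<close>
primrec stopped :: "(real \<Rightarrow> real \<Rightarrow> real) \<Rightarrow> real \<Rightarrow> (real \<Rightarrow> real \<Rightarrow> real) \<Rightarrow> nat \<Rightarrow> real \<Rightarrow> real \<Rightarrow> real" where
  "stopped F l G 0 c d = (if F c d > l * (d - c) then G c d else 0)"
| "stopped F l G (Suc N) c d = (if F c d > l * (d - c) then G c d
     else stopped F l G N c (mid c d) + stopped F l G N (mid c d) d)"

text \<open>
  The integral over $(c,d]$ of the power $1 + e$ of the conditional expectation of \<open>F\<close> on the
  dyadic intervals of generation \<open>N\<close>.
\<close>
primrec energy :: "(real \<Rightarrow> real \<Rightarrow> real) \<Rightarrow> real \<Rightarrow> nat \<Rightarrow> real \<Rightarrow> real \<Rightarrow> real" where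
  "energy F e 0 c d = F c d * (F c d / (d - c)) powr e"
| "energy F e (Suc N) c d = energy F e N c (mid c d) + energy F e N (mid c d) d"

text \<open>Additivity at midpoints: these are the subdivisions that a dyadic recursion makes.\<close>
definition interval_mass :: "real \<Rightarrow> real \<Rightarrow> (real \<Rightarrow> real \<Rightarrow> real) \<Rightarrow> bool" where
  "interval_mass a b F \<longleftrightarrow> (\<forall>c d. a \<le> c \<and> c < d \<and> d \<le> b \<longrightarrow>
     0 \<le> F c d \<and> F c d = F c (mid c d) + F (mid c d) d)"

lemma ennreal_max: "ennreal (max x y) = max (ennreal x) (ennreal y)"
  by (intro max_of_mono[symmetric] monoI ennreal_leI)

lemma interval_massD:
  assumes "interval_mass a b F" "a \<le> c" "c < d" "d \<le> b"
  shows "0 \<le> F c d" "F c d = F c (mid c d) + F (mid c d) d"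
    "F c (mid c d) \<le> F c d" "F (mid c d) d \<le> F c d"
proof -
  have *: "0 \<le> F c' d'" "F c' d' = F c' (mid c' d') + F (mid c' d') d'"
    if "a \<le> c'" "c' < d'" "d' \<le> b" for c' d'
    using assms(1) that unfolding interval_mass_def by blast+
  show A: "0 \<le> F c d" "F c d = F c (mid c d) + F (mid c d) d"
    using *[of c d] assms by auto
  have "0 \<le> F c (mid c d)" "0 \<le> F (mid c d) d"
    using *(1)[of c "mid c d"] *(1)[of "mid c d" d] assms by auto
  then show "F c (mid c d) \<le> F c d" "F (mid c d) d \<le> F c d"
    using A by linarith+
qed

lemma stopped_stop: "F c d > l * (d - c) \<Longrightarrow> stopped F l G N c d = G c d"
  by (cases N) auto

lemma stopped_bounds:
  assumes "interval_mass a b F" "interval_mass a b G" "a \<le> c" "c < d" "d \<le> b"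
  shows "0 \<le> stopped F l G N c d \<and> stopped F l G N c d \<le> G c d"
  using assms(3-)
proof (induction N arbitrary: c d)
  case 0
  then show ?case using interval_massD(1)[OF assms(2)] by auto
next
  case (Suc N)
  show ?case
    using Suc.IH[of c "mid c d"] Suc.IH[of "mid c d" d] Suc.prems
      interval_massD(1,2)[OF assms(2), of c d]
    by (auto simp: field_simps)
qed

lemma stopped_antimono:
  assumes "interval_mass a b F" "interval_mass a b G" "l \<le> l'" "a \<le> c" "c < d" "d \<le> b"
  shows "stopped F l' G N c d \<le> stopped F l G N c d"
  using assms(4-)
proof (induction N arbitrary: c d)
  case 0
  have "l * (d - c) \<le> l' * (d - c)" using 0 assms(3) by (intro mult_right_mono) auto
  then have "F c d > l' * (d - c) \<Longrightarrow> F c d > l * (d - c)" by linarith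
  then show ?case using interval_massD(1)[OF assms(2), of c d] 0 by auto
next
  case (Suc N)
  have *: "l * (d - c) \<le> l' * (d - c)" using Suc.prems assms(3) by (intro mult_right_mono) auto
  consider "F c d > l * (d - c)" | "\<not> F c d > l * (d - c)" by blast
  then show ?case
  proof cases
    case 1
    then show ?thesis
      using stopped_bounds[OF assms(1,2) Suc.prems, of l' "Suc N"] by (simp only: stopped_stop)
  next
    case 2
    then have "\<not> F c d > l' * (d - c)" using * by linarith
    with 2 show ?thesis using Suc.IH[of c "mid c d"] Suc.IH[of "mid c d" d] Suc.prems
      by auto
  qed
qed

text \<open>
  A selected interval has an unselected parent of twice its length, hence its average is at most
  twice the level. This is where the average over $(c,d]$ itself has to be at most \<open>l\<close>.
\<close>
lemma stopped_mass_le_twice_length: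
  assumes "interval_mass a b F" "0 \<le> l" "F c d \<le> l * (d - c)" "a \<le> c" "c < d" "d \<le> b"
  shows "stopped F l F N c d \<le> 2 * l * stopped F l (\<lambda>c d. d - c) N c d"
  using assms(3-)
proof (induction N arbitrary: c d)
  case 0
  then show ?case by simp
next
  case (Suc N)
  note prems = Suc.prems
  let ?m = "mid c d"
  have half: "stopped F l F N p q \<le> 2 * l * stopped F l (\<lambda>c d. d - c) N p q"
    if pq: "a \<le> p" "p < q" "q \<le> b" "2 * (q - p) = d - c" "F p q \<le> F c d" for p q
  proof (cases "F p q > l * (q - p)")
    case True
    have "F p q \<le> l * (2 * (q - p))" unfolding pq(4) using pq(5) prems(1) by linarith
    moreover have "stopped F l G N p q = G p q" for G using True by (rule stopped_stop)
    ultimately show ?thesis by (simp add: algebra_simps)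
  next
    case False
    then show ?thesis using Suc.IH[of p q] pq by simp
  qed
  have "stopped F l F N c ?m \<le> 2 * l * stopped F l (\<lambda>c d. d - c) N c ?m"
    "stopped F l F N ?m d \<le> 2 * l * stopped F l (\<lambda>c d. d - c) N ?m d"
    using prems interval_massD(3,4)[OF assms(1) prems(2-4)]
    by (intro half; simp add: field_simps)+
  then show ?case using prems(1) by (simp add: algebra_simps)
qed

text \<open>
  The layer-cake estimate from below. Applied to the maximum of the averages at a point, \<open>g\<close> says that
  the weights \<open>w k\<close> of the levels exceeded there add up to at most that maximum; integrating
  gives the claim. In the recursion a level already exceeded by \<open>s\<close> counts the full length.
\<close>
lemma level_sums_le_dyadic_max:
  assumes "interval_mass a b F" and "0 \<le> s" "a \<le> c" "c < d" "d \<le> b"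
    and g: "\<And>t. 0 \<le> t \<Longrightarrow> (\<Sum>k\<in>K. if t > l k then w k else 0) \<le> t" and fin: "finite K"
    and w: "\<And>k. k \<in> K \<Longrightarrow> 0 \<le> w k"
  shows "ennreal (\<Sum>k\<in>K. w k * (if s > l k then d - c else stopped F (l k) (\<lambda>c d. d - c) N c d))
    \<le> dyadic_max N (\<lambda>c d. ennreal (F c d)) (ennreal s) c d"
  using assms(2-5)
proof (induction N arbitrary: s c d)
  case 0
  let ?t = "max s (F c d / (d - c))"
  have Fp: "0 \<le> F c d" using interval_massD(1)[OF assms(1)] 0 by auto
  have t0: "0 \<le> ?t" using 0 by auto
  have "(\<Sum>k\<in>K. w k * (if s > l k then d - c else stopped F (l k) (\<lambda>c d. d - c) 0 c d))
      = (\<Sum>k\<in>K. if ?t > l k then w k else 0) * (d - c)"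
    unfolding sum_distrib_right using 0 by (intro sum.cong) (auto simp: field_simps less_max_iff_disj)
  also have "\<dots> \<le> ?t * (d - c)" using g[OF t0] 0 by (intro mult_right_mono) auto
  finally have "ennreal (\<Sum>k\<in>K. w k * (if s > l k then d - c else stopped F (l k) (\<lambda>c d. d - c) 0 c d))
    \<le> ennreal (?t * (d - c))" by (rule ennreal_leI)
  also have "\<dots> = max (ennreal s) (ennreal (F c d) / ennreal (d - c)) * ennreal (d - c)"
    using 0 Fp t0 by (simp add: ennreal_mult divide_ennreal ennreal_max)
  finally show ?case by simp
next
  case (Suc N)
  let ?t = "max s (F c d / (d - c))"
  let ?m = "mid c d"
  have Fp: "0 \<le> F c d" using interval_massD(1)[OF assms(1)] Suc.prems by auto
  have t0: "0 \<le> ?t" using Suc.prems by auto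
  define P where "P = (\<lambda>c d. (\<Sum>k\<in>K. w k * (if ?t > l k then d - c else stopped F (l k) (\<lambda>c d. d - c) N c d)))"
  have P0: "0 \<le> P p q" if "a \<le> p" "p < q" "q \<le> b" for p q
    unfolding P_def using that w stopped_bounds[OF assms(1) _ that, of "\<lambda>c d. d - c" _ N]
    by (intro sum_nonneg mult_nonneg_nonneg) (auto simp: interval_mass_def field_simps)
  have "(\<Sum>k\<in>K. w k * (if s > l k then d - c else stopped F (l k) (\<lambda>c d. d - c) (Suc N) c d))
      = P c ?m + P ?m d"
    unfolding P_def sum.distrib[symmetric] using Suc.prems
    by (intro sum.cong) (auto simp: field_simps less_max_iff_disj)
  also have "ennreal \<dots> = ennreal (P c ?m) + ennreal (P ?m d)"
    using Suc.prems P0 by (intro ennreal_plus) auto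
  also have "\<dots> \<le> dyadic_max N (\<lambda>c d. ennreal (F c d)) (ennreal ?t) c ?m +
      dyadic_max N (\<lambda>c d. ennreal (F c d)) (ennreal ?t) ?m d"
    unfolding P_def using Suc.prems t0 by (intro add_mono Suc.IH) auto
  also have "ennreal ?t = max (ennreal s) (ennreal (F c d) / ennreal (d - c))"
    using Suc.prems Fp by (simp add: divide_ennreal ennreal_max)
  finally show ?case by simp
qed

text \<open>The increments $2^k u - 2^{k-1} u = 2^k u / 2$ telescope up to the last level below \<open>t\<close>.\<close>
lemma geometric_levels_le:
  assumes "0 < u" "0 \<le> t"
  shows "(\<Sum>k\<in>{1..m}. if t > 2 ^ k * u then 2 ^ k * u / 2 else 0) \<le> (t::real)"
proof -
  have "(\<Sum>k\<in>{1..m}. if t > 2 ^ k * u then 2 ^ k * u / 2 else 0) \<le> min t (2 ^ m * u)"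
  proof (induction m)
    case 0 then show ?case using assms by simp
  next
    case (Suc m)
    have "(\<Sum>k\<in>{1..Suc m}. if t > 2 ^ k * u then 2 ^ k * u / 2 else 0)
      = (\<Sum>k\<in>{1..m}. if t > 2 ^ k * u then 2 ^ k * u / 2 else 0) +
        (if t > 2 ^ Suc m * u then 2 ^ Suc m * u / 2 else 0)"
      by simp
    also have "\<dots> \<le> min t (2 ^ Suc m * u)"
    proof (cases "t > 2 ^ Suc m * u")
      case True
      then show ?thesis using Suc by (simp add: mult.commute)
    next
      case False
      then show ?thesis using Suc by simp
    qed
    finally show ?case .
  qed
  then show ?thesis by linarith
qed

definition dyadic_A_infty :: "real \<Rightarrow> (real \<Rightarrow> real \<Rightarrow> ennreal) \<Rightarrow> real \<Rightarrow> real \<Rightarrow> bool" where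
  "dyadic_A_infty A V a b \<longleftrightarrow> (\<forall>N c d. a \<le> c \<and> c < d \<and> d \<le> b \<longrightarrow>
     dyadic_max N V 0 c d \<le> ennreal A * V c d)"

text \<open>
  Each of the \<open>m\<close> layers $2^k u$ contributes at least a quarter of the mass stopped at the top
  level, because that mass is also stopped at level $2^k u$ and has density at most $2^{k+1} u$ there.
  All layers together contribute at most \<open>A\<close> times the total mass.
\<close>
lemma stopped_mass_le_half:
  assumes F: "interval_mass a b F" and A: "dyadic_A_infty A (\<lambda>c d. ennreal (F c d)) a b"
    and m: "8 * A \<le> real m" "1 \<le> A" and cd: "a \<le> c" "c < d" "d \<le> b"
  shows "stopped F (2 ^ m * (F c d / (d - c))) F N c d \<le> F c d / 2"
proof -
  let ?L = "\<lambda>c d::real. d - c"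
  define u where "u = F c d / (d - c)"
  have F0: "0 \<le> F c d" using interval_massD(1)[OF F cd] .
  have L: "interval_mass a b ?L" by (auto simp: interval_mass_def field_simps)
  show ?thesis
  proof (cases "F c d = 0")
    case True
    then show ?thesis using stopped_bounds[OF F F cd, of "2 ^ m * (F c d / (d - c))" N] by simp
  next
    case False
    then have u: "0 < u" using F0 cd by (simp add: u_def)
    define S where "S = stopped F (2 ^ m * u) F N c d"
    have S0: "0 \<le> S" using stopped_bounds[OF F F cd] S_def by auto
    have lev: "S / 4 \<le> 2 ^ k * u / 2 * stopped F (2 ^ k * u) ?L N c d" if k: "k \<in> {1..m}" for k
    proof -
      have "F c d = u * (d - c)" using cd by (simp add: u_def)
      also have "\<dots> \<le> 2 ^ k * u * (d - c)" using u cd by (intro mult_right_mono) auto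
      finally have *: "F c d \<le> 2 ^ k * u * (d - c)" .
      have "(2::real) ^ k * u \<le> 2 ^ m * u" using k u by (intro mult_right_mono power_increasing) auto
      then have "S \<le> stopped F (2 ^ k * u) F N c d"
        unfolding S_def by (intro stopped_antimono[OF F F _ cd])
      also have "\<dots> \<le> 2 * (2 ^ k * u) * stopped F (2 ^ k * u) ?L N c d"
        using u by (intro stopped_mass_le_twice_length[OF F _ * cd]) auto
      finally show ?thesis by simp
    qed
    have "real m * S / 4 = (\<Sum>k\<in>{1..m}. S / 4)" by simp
    also have "\<dots> \<le> (\<Sum>k\<in>{1..m}. 2 ^ k * u / 2 *
        (if 0 > 2 ^ k * u then d - c else stopped F (2 ^ k * u) ?L N c d))"
    proof (rule sum_mono)
      fix k assume k: "k \<in> {1..m}"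
      have "\<not> 0 > 2 ^ k * u" using u by (simp add: not_less)
      then show "S / 4 \<le> 2 ^ k * u / 2 *
        (if 0 > 2 ^ k * u then d - c else stopped F (2 ^ k * u) ?L N c d)" using lev[OF k] by auto
    qed
    finally have "ennreal (real m * S / 4) \<le> ennreal \<dots>" by (rule ennreal_leI)
    also have "\<dots> \<le> dyadic_max N (\<lambda>c d. ennreal (F c d)) (ennreal 0) c d"
      using u cd geometric_levels_le[OF u, where m = m]
      by (intro level_sums_le_dyadic_max[OF F]) (auto simp del: One_nat_def)
    also have "\<dots> \<le> ennreal A * ennreal (F c d)"
      using A cd by (auto simp: dyadic_A_infty_def)
    also have "\<dots> = ennreal (A * F c d)" using m F0 by (simp add: ennreal_mult)
    finally have "real m * S / 4 \<le> A * F c d" using m F0 by (simp add: ennreal_le_iff)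
    moreover have "8 * A * S \<le> real m * S" using m S0 by (intro mult_right_mono)
    ultimately have "A * (2 * S) \<le> A * F c d" by simp
    then have "2 * S \<le> F c d" using m by simp
    then show ?thesis by (simp add: S_def u_def)
  qed
qed

text \<open>
  The induction step for \<open>energy_bound\<close>: off the intervals stopped at level \<open>l\<close> the averages are at most
  \<open>l\<close>, and a stopped interval is a proper dyadic subinterval, so that it has fewer generations left
  and the bound assumed for fewer generations applies to it, with an average of at most \<open>2 * l\<close>.
\<close>
lemma energy_le_stopped:
  assumes F: "interval_mass a b F" and "0 \<le> l" "0 \<le> e"
    and hyp: "\<And>N' c d. N' < N0 \<Longrightarrow> a \<le> c \<Longrightarrow> c < d \<Longrightarrow> d \<le> b \<Longrightarrow>
      energy F e N' c d \<le> 6 * F c d * (F c d / (d - c)) powr e"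
    and "N \<le> N0" "F c d \<le> l * (d - c)" "a \<le> c" "c < d" "d \<le> b"
  shows "energy F e N c d \<le> l powr e * F c d + 6 * (2 * l) powr e * stopped F l F N c d"
  using assms(5-)
proof (induction N arbitrary: c d)
  case 0
  have F0: "0 \<le> F c d" using interval_massD(1)[OF F] 0 by blast
  have "(F c d / (d - c)) powr e \<le> l powr e"
    using 0 F0 assms(2,3) by (intro powr_mono2) (auto simp: field_simps)
  then have "F c d * (F c d / (d - c)) powr e \<le> F c d * l powr e"
    using F0 by (rule mult_left_mono)
  then show ?case using 0 by (simp add: mult.commute)
next
  case (Suc N)
  note prems = Suc.prems
  let ?m = "mid c d"
  have half: "energy F e N p q \<le> l powr e * F p q + 6 * (2 * l) powr e * stopped F l F N p q"
    if pq: "a \<le> p" "p < q" "q \<le> b" "2 * (q - p) = d - c" "F p q \<le> F c d" for p q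
  proof (cases "F p q > l * (q - p)")
    case True
    have F0: "0 \<le> F p q" using interval_massD(1)[OF F pq(1-3)] .
    have "F p q \<le> l * (2 * (q - p))" unfolding pq(4) using pq(5) prems(2) by linarith
    then have *: "(F p q / (q - p)) powr e \<le> (2 * l) powr e"
      using pq F0 assms(2,3) by (intro powr_mono2) (auto simp: field_simps)
    have "energy F e N p q \<le> 6 * F p q * (F p q / (q - p)) powr e"
      using hyp[of N p q] pq prems by simp
    also have "\<dots> \<le> 6 * F p q * (2 * l) powr e"
      using * F0 by (intro mult_left_mono) auto
    also have "\<dots> = 6 * (2 * l) powr e * stopped F l F N p q"
      using True by (simp add: stopped_stop)
    finally show ?thesis using F0 by (smt (verit) mult_nonneg_nonneg powr_ge_zero)
  next
    case False
    then show ?thesis using Suc.IH[of p q] pq prems by simp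
  qed
  have "energy F e (Suc N) c d \<le> (l powr e * F c ?m + 6 * (2 * l) powr e * stopped F l F N c ?m) +
     (l powr e * F ?m d + 6 * (2 * l) powr e * stopped F l F N ?m d)"
    unfolding energy.simps using prems interval_massD(3,4)[OF F prems(3-5)]
    by (intro add_mono half) (auto simp: field_simps)
  also have "\<dots> = l powr e * F c d + 6 * (2 * l) powr e * stopped F l F (Suc N) c d"
  proof -
    have "stopped F l F (Suc N) c d = stopped F l F N c ?m + stopped F l F N ?m d"
      using prems(2) by simp
    then show ?thesis by (subst interval_massD(2)[OF F prems(3-5)]) (simp add: algebra_simps)
  qed
  finally show ?case .
qed

text \<open>
  The constant 6 is the fixed point of $x \mapsto 3/2 + (3/2)(x/2)$: the part off the stopped intervals
  costs the factor $K^e \le 3/2$, and the stopped ones cost $(2K)^e \le 3/2$ and have half the mass.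
\<close>
lemma energy_bound:
  assumes F: "interval_mass a b F" and A: "dyadic_A_infty A (\<lambda>c d. ennreal (F c d)) a b"
    and "1 \<le> A" "0 < e" "20 * A * e \<le> 1"
    and "a \<le> c" "c < d" "d \<le> b"
  shows "energy F e N c d \<le> 6 * F c d * (F c d / (d - c)) powr e"
  using assms(6-)
proof (induction N arbitrary: c d rule: less_induct)
  case (less N)
  define m where "m = nat \<lceil>8 * A\<rceil>"
  have m: "8 * A \<le> real m" "real m \<le> 8 * A + 1" unfolding m_def using assms(3) by linarith+
  define K where "K = (2::real) ^ m"
  have K: "1 \<le> K" by (simp add: K_def)
  define u where "u = F c d / (d - c)"
  have F0: "0 \<le> F c d" using interval_massD(1)[OF F less.prems] .
  have u: "0 \<le> u" "F c d = u * (d - c)" using F0 less.prems by (auto simp: u_def)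
  \<comment> \<open>$2 K = 2^{m+1}$ and $m + 1 \le 10 A$, so the exponent is at most $10 A e \le 1/2$.\<close>
  have twoK: "(2 * K) powr e \<le> 3 / 2"
  proof -
    have "2 * K = 2 powr (real (Suc m))" unfolding K_def by (subst powr_realpow) auto
    then have "(2 * K) powr e = 2 powr (real (Suc m) * e)" by (simp add: powr_powr)
    also have "\<dots> \<le> 2 powr (1 / 2)"
    proof -
      have "real (Suc m) * e \<le> 10 * A * e" using m assms(3,4) by (intro mult_right_mono) auto
      then show ?thesis using assms(5) by simp
    qed
    also have "\<dots> = sqrt 2" by (simp add: powr_half_sqrt)
    also have "\<dots> \<le> 3 / 2" by (rule real_le_lsqrt) (simp_all add: power2_eq_square)
    finally show ?thesis .
  qed
  have Ke: "K powr e \<le> (2 * K) powr e" using K assms(4) by (intro powr_mono2) auto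
  have "F c d \<le> K * u * (d - c)"
    using u K less.prems mult_right_mono[of 1 K "u * (d - c)"] by (simp add: mult.assoc)
  then have "energy F e N c d \<le> (K * u) powr e * F c d + 6 * (2 * (K * u)) powr e * stopped F (K * u) F N c d"
    using K u assms(4) by (intro energy_le_stopped[OF F _ _ less.IH _ _ less.prems]) auto
  also have "\<dots> \<le> (K * u) powr e * F c d + 6 * (2 * (K * u)) powr e * (F c d / 2)"
    using stopped_mass_le_half[OF F A m(1) assms(3) less.prems, of N]
    by (intro add_mono mult_left_mono) (auto simp: K_def u_def)
  also have "\<dots> = (K powr e + 3 * (2 * K) powr e) * (u powr e * F c d)"
    using K u by (simp add: powr_mult algebra_simps)
  also have "\<dots> \<le> 6 * (u powr e * F c d)"
    using twoK Ke F0 by (intro mult_right_mono) auto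
  finally show ?case by (simp add: u_def mult_ac)
qed

section \<open>The reverse Hoelder inequality on an interval\<close>

primrec dyadic_cell :: "nat \<Rightarrow> real \<Rightarrow> real \<Rightarrow> real \<Rightarrow> real \<times> real" where
  "dyadic_cell 0 c d x = (c, d)"
| "dyadic_cell (Suc N) c d x =
     (if x \<le> mid c d then dyadic_cell N c (mid c d) x else dyadic_cell N (mid c d) d x)"

lemma dyadic_cell_bounds:
  assumes "c \<le> x" "x \<le> d" "c < d" "dyadic_cell N c d x = (p, q)"
  shows "c \<le> p \<and> p \<le> x \<and> x \<le> q \<and> q \<le> d \<and> q - p = (d - c) / 2 ^ N"
  using assms
proof (induction N arbitrary: c d)
  case 0
  then show ?case by simp
next
  case (Suc N)
  show ?case
  proof (cases "x \<le> mid c d")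
    case True
    have "c \<le> p \<and> p \<le> x \<and> x \<le> q \<and> q \<le> mid c d \<and> q - p = (mid c d - c) / 2 ^ N"
      using Suc.prems True by (intro Suc.IH) auto
    then show ?thesis using Suc.prems by (auto simp: field_simps)
  next
    case False
    have "mid c d \<le> p \<and> p \<le> x \<and> x \<le> q \<and> q \<le> d \<and> q - p = (d - mid c d) / 2 ^ N"
      using Suc.prems False by (intro Suc.IH) auto
    then show ?thesis using Suc.prems by (auto simp: field_simps)
  qed
qed

lemma measurable_dyadic_cell: "(\<lambda>x. G (dyadic_cell N c d x)) \<in> borel_measurable borel"
proof (induction N arbitrary: c d)
  case (Suc N)
  have "(\<lambda>x. if x \<le> mid c d then G (dyadic_cell N c (mid c d) x) else G (dyadic_cell N (mid c d) d x))
    \<in> borel_measurable borel"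
    using Suc by measurable
  then show ?case by (simp add: if_distrib)
qed simp

definition cell_average :: "(real \<Rightarrow> real \<Rightarrow> real) \<Rightarrow> real \<times> real \<Rightarrow> real" where
  "cell_average F I = F (fst I) (snd I) / (snd I - fst I)"

lemma energy_eq_nn_integral:
  assumes F: "interval_mass a b F" and "0 \<le> e" "a \<le> c" "c < d" "d \<le> b"
  shows "(\<integral>\<^sup>+x\<in>{c<..d}. ennreal (cell_average F (dyadic_cell N c d x) powr (1 + e)) \<partial>lborel)
    = ennreal (energy F e N c d) \<and> 0 \<le> energy F e N c d"
  using assms(3-)
proof (induction N arbitrary: c d)
  case 0
  have F0: "0 \<le> F c d" using interval_massD(1)[OF F 0] .
  have "(F c d / (d - c)) powr (1 + e) * (d - c) = F c d * (F c d / (d - c)) powr e"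
    using 0 F0 by (cases "F c d = 0") (auto simp: powr_add)
  then show ?case using 0 F0
    by (simp add: cell_average_def nn_integral_cmult ennreal_mult' [symmetric])
next
  case (Suc N)
  let ?m = "mid c d"
  let ?f = "\<lambda>N c d x. ennreal (cell_average F (dyadic_cell N c d x) powr (1 + e))"
  have meas: "?f N c d \<in> borel_measurable lborel" for N c d
    using measurable_dyadic_cell[of "\<lambda>I. ennreal (cell_average F I powr (1 + e))" N c d]
    by (simp add: measurable_lborel1)
  have U: "{c<..d} = {c<..?m} \<union> {?m<..d}" using Suc.prems by auto
  have "(\<integral>\<^sup>+x\<in>{c<..d}. ?f (Suc N) c d x \<partial>lborel)
    = (\<integral>\<^sup>+x\<in>{c<..?m}. ?f (Suc N) c d x \<partial>lborel) + (\<integral>\<^sup>+x\<in>{?m<..d}. ?f (Suc N) c d x \<partial>lborel)"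
    unfolding U by (intro nn_integral_disjoint_pair meas) auto
  also have "(\<integral>\<^sup>+x\<in>{c<..?m}. ?f (Suc N) c d x \<partial>lborel) = (\<integral>\<^sup>+x\<in>{c<..?m}. ?f N c ?m x \<partial>lborel)"
    by (intro nn_integral_cong) (auto simp: indicator_def)
  also have "(\<integral>\<^sup>+x\<in>{?m<..d}. ?f (Suc N) c d x \<partial>lborel) = (\<integral>\<^sup>+x\<in>{?m<..d}. ?f N ?m d x \<partial>lborel)"
    by (intro nn_integral_cong) (auto simp: indicator_def)
  finally show ?case using Suc.IH[of c ?m] Suc.IH[of ?m d] Suc.prems by simp
qed

text \<open>
  Differentiation along intervals that contain the point, obtained from the one-sided statement for
  $v$ and for its reflection: an average over $[p,q]$ is a convex combination of averages over
  $[p,x]$ and $[x,q]$.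
\<close>
lemma AE_interval_averages_converge:
  fixes v :: "real \<Rightarrow> real"
  assumes v: "\<And>a b. v integrable_on {a..b}"
  shows "AE x in lborel. \<forall>e>0. \<exists>D>0. \<forall>p q. p \<le> x \<and> x \<le> q \<and> p < q \<and> q - p < D \<longrightarrow>
    \<bar>integral {p..q} v / (q - p) - v x\<bar> \<le> e"
proof -
  have v': "(\<lambda>t. v (- t)) integrable_on {a..b}" for a b
    using v[of "-b" "-a"] Henstock_Kurzweil_Integration.integrable_reflect_real[where f = v and a = "-b" and b = "-a"] by simp
  obtain N1 where N1: "negligible N1"
    "\<And>x e. \<lbrakk>x \<notin> N1; 0 < e\<rbrakk> \<Longrightarrow> \<exists>d>0. \<forall>h. 0 < h \<and> h < d \<longrightarrow>
       norm (integral {x..x + h} v / h - v x) < e"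
    using integrable_ccontinuous_explicit[of v] v by (auto simp: cbox_interval divide_inverse_commute)
  obtain N2 where N2: "negligible N2"
    "\<And>x e. \<lbrakk>x \<notin> N2; 0 < e\<rbrakk> \<Longrightarrow> \<exists>d>0. \<forall>h. 0 < h \<and> h < d \<longrightarrow>
       norm (integral {x..x + h} (\<lambda>t. v (- t)) / h - v (- x)) < e"
    using integrable_ccontinuous_explicit[of "\<lambda>t. v (- t)"] v' by (auto simp: cbox_interval divide_inverse_commute)
  have "negligible (uminus ` N2)"
    using N2(1) by (intro negligible_differentiable_image_negligible)
      (auto intro!: derivative_intros simp: differentiable_on_minus differentiable_on_ident)
  then have "negligible (N1 \<union> uminus ` N2)" using N1(1) by simp
  then have ae: "AE x in lborel. x \<notin> N1 \<union> uminus ` N2"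
    unfolding negligible_iff_null_sets by (subst AE_completion_iff[symmetric]) (rule AE_not_in)
  show ?thesis
    using ae
  proof (eventually_elim, intro allI impI)
    fix x e :: real
    assume x: "x \<notin> N1 \<union> uminus ` N2" and e: "0 < e"
    have x1: "x \<notin> N1" and x2: "- x \<notin> N2" using x by force+
    obtain d1 where d1: "d1 > 0" "\<And>h. 0 < h \<Longrightarrow> h < d1 \<Longrightarrow> \<bar>integral {x..x + h} v / h - v x\<bar> < e"
      using N1(2)[OF x1 e] by auto
    obtain d2 where d2: "d2 > 0" "\<And>h. 0 < h \<Longrightarrow> h < d2 \<Longrightarrow>
        \<bar>integral {-x..-x + h} (\<lambda>t. v (- t)) / h - v x\<bar> < e"
      using N2(2)[OF x2 e] by auto
    have R: "\<bar>integral {x..q} v - (q - x) * v x\<bar> \<le> (q - x) * e" if "x \<le> q" "q - x < d1" for q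
    proof (cases "x = q")
      case False
      then have h: "0 < q - x" using that by simp
      have "integral {x..q} v - (q - x) * v x = (q - x) * (integral {x..x + (q - x)} v / (q - x) - v x)"
        using h by (simp add: right_diff_distrib)
      then have "\<bar>integral {x..q} v - (q - x) * v x\<bar> = (q - x) * \<bar>integral {x..x + (q - x)} v / (q - x) - v x\<bar>"
        using h by (metis abs_mult abs_of_pos)
      also have "\<dots> \<le> (q - x) * e" using d1(2)[OF h] that h by (intro mult_left_mono) auto
      finally show ?thesis .
    qed simp
    have L: "\<bar>integral {p..x} v - (x - p) * v x\<bar> \<le> (x - p) * e" if "p \<le> x" "x - p < d2" for p
    proof (cases "x = p")
      case False
      then have h: "0 < x - p" using that by simp
      have "integral {-x..-x + (x - p)} (\<lambda>t. v (- t)) = integral {p..x} v"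
        using integral_reflect_real[of x p v] by simp
      then have "integral {p..x} v - (x - p) * v x =
          (x - p) * (integral {-x..-x + (x - p)} (\<lambda>t. v (- t)) / (x - p) - v x)"
        using h by (simp add: right_diff_distrib)
      then have "\<bar>integral {p..x} v - (x - p) * v x\<bar> =
          (x - p) * \<bar>integral {-x..-x + (x - p)} (\<lambda>t. v (- t)) / (x - p) - v x\<bar>"
        using h by (metis abs_mult abs_of_pos)
      also have "\<dots> \<le> (x - p) * e" using d2(2)[OF h] that h by (intro mult_left_mono) auto
      finally show ?thesis .
    qed simp
    show "\<exists>D>0. \<forall>p q. p \<le> x \<and> x \<le> q \<and> p < q \<and> q - p < D \<longrightarrow>
      \<bar>integral {p..q} v / (q - p) - v x\<bar> \<le> e"
    proof (intro exI[of _ "min d1 d2"] conjI allI impI)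
      fix p q assume pq: "p \<le> x \<and> x \<le> q \<and> p < q \<and> q - p < min d1 d2"
      have I: "integral {p..q} v = integral {p..x} v + integral {x..q} v"
        using pq v by (intro Henstock_Kurzweil_Integration.integral_combine[symmetric]) auto
      have "\<bar>integral {p..q} v - (q - p) * v x\<bar> \<le> (q - p) * e"
        using R[of q] L[of p] pq unfolding I by (simp add: algebra_simps abs_le_iff)
      then have "\<bar>(integral {p..q} v - (q - p) * v x) / (q - p)\<bar> \<le> e"
        using pq by (simp add: abs_divide field_simps)
      then show "\<bar>integral {p..q} v / (q - p) - v x\<bar> \<le> e" using pq by (simp add: diff_divide_distrib)
    qed (use d1 d2 in auto)
  qed
qed

definition mass :: "(real \<Rightarrow> ennreal) \<Rightarrow> real \<Rightarrow> real \<Rightarrow> ennreal" where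
  "mass v c d = (\<integral>\<^sup>+x\<in>{c..d}. v x \<partial>lborel)"

lemma mass_half_open:
  "mass v c d = (\<integral>\<^sup>+x\<in>{c<..d}. v x \<partial>lborel)"
proof -
  have "AE x in lborel. x \<noteq> c"
    by (rule AE_lborel_singleton)
  then show ?thesis unfolding mass_def
    by (intro nn_integral_cong_AE) (auto elim!: eventually_mono simp: indicator_def)
qed

lemma mass_split:
  assumes [measurable]: "v \<in> borel_measurable borel" and "c \<le> m" "m \<le> d"
  shows "mass v c d = mass v c m + mass v m d"
proof -
  have U: "{c<..d} = {c<..m} \<union> {m<..d}" using assms by auto
  show ?thesis unfolding mass_half_open U by (intro nn_integral_disjoint_pair) auto
qed

lemma interval_mass_mass:
  assumes v: "v \<in> borel_measurable borel" and fin: "mass v a b < top"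
  shows "interval_mass a b (\<lambda>c d. enn2real (mass v c d))"
  unfolding interval_mass_def
proof (intro allI impI conjI)
  fix c d assume cd: "a \<le> c \<and> c < d \<and> d \<le> b"
  have "mass v c d \<le> mass v a b"
    unfolding mass_def using cd by (intro nn_integral_mono) (auto simp: indicator_def)
  then have "mass v c d < top" using fin by (rule le_less_trans)
  then show "enn2real (mass v c d) = enn2real (mass v c (mid c d)) + enn2real (mass v (mid c d) d)"
    using mass_split[OF v, of c "mid c d" d] cd by (simp add: enn2real_plus)
qed simp

lemma AE_dyadic_averages_converge:
  assumes [measurable]: "v \<in> borel_measurable borel" and fin: "\<And>a b. mass v a b < top"
  shows "AE x in lborel. v x < top \<and> (\<forall>c d. c \<le> x \<and> x \<le> d \<and> c < d \<longrightarrow>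
    (\<lambda>N. cell_average (\<lambda>c d. enn2real (mass v c d)) (dyadic_cell N c d x)) \<longlonglongrightarrow> enn2real (v x))"
proof -
  have "AE x in lborel. v x * indicator {- real n..real n} x < top" for n :: nat
    using nn_integral_PInf_AE[of "\<lambda>x. v x * indicator {- real n..real n} x" lborel] fin[of "- real n" "real n"]
    by (simp add: mass_def less_top)
  then have "AE x in lborel. \<forall>n::nat. v x * indicator {- real n..real n} x < top"
    unfolding AE_all_countable by blast
  then have top: "AE x in lborel. v x < top"
  proof eventually_elim
    fix x assume *: "\<forall>n::nat. v x * indicator {- real n..real n} x < top"
    obtain n :: nat where "\<bar>x\<bar> \<le> real n" using real_arch_simple by blast
    then show "v x < top" using *[rule_format, of n] by (auto simp: indicator_def abs_le_iff)
  qed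
  have hi: "((\<lambda>x. enn2real (v x)) has_integral enn2real (mass v a b)) {a..b}" for a b
  proof -
    have "(\<integral>\<^sup>+x. ennreal (enn2real (v x) * indicator {a..b} x) \<partial>lborel) = mass v a b"
      unfolding mass_def using top
      by (intro nn_integral_cong_AE) (auto elim!: eventually_mono simp: indicator_def less_top)
    also have "\<dots> = ennreal (enn2real (mass v a b))" using fin[of a b] by (simp add: less_top)
    finally have "((\<lambda>x. enn2real (v x) * indicator {a..b} x) has_integral enn2real (mass v a b)) UNIV"
      by (intro nn_integral_has_integral) auto
    also have "(\<lambda>x. enn2real (v x) * indicator {a..b} x) = (\<lambda>x. if x \<in> {a..b} then enn2real (v x) else 0)"
      by (auto simp: indicator_def)
    finally show ?thesis by (simp only: has_integral_restrict_UNIV)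
  qed
  then have "(\<lambda>x. enn2real (v x)) integrable_on {a..b}" for a b by blast
  from AE_interval_averages_converge[OF this] top show ?thesis
  proof (eventually_elim, intro conjI allI impI)
    fix x c d
    assume lim: "\<forall>e>0. \<exists>D>0. \<forall>p q. p \<le> x \<and> x \<le> q \<and> p < q \<and> q - p < D \<longrightarrow>
      \<bar>integral {p..q} (\<lambda>x. enn2real (v x)) / (q - p) - enn2real (v x)\<bar> \<le> e"
      and cd: "c \<le> x \<and> x \<le> d \<and> c < d"
    show "(\<lambda>N. cell_average (\<lambda>c d. enn2real (mass v c d)) (dyadic_cell N c d x)) \<longlonglongrightarrow> enn2real (v x)"
    proof (rule tendstoI)
      fix e :: real assume e: "0 < e"
      obtain D where D: "0 < D" "\<And>p q. p \<le> x \<Longrightarrow> x \<le> q \<Longrightarrow> p < q \<Longrightarrow> q - p < D \<Longrightarrow>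
          \<bar>integral {p..q} (\<lambda>x. enn2real (v x)) / (q - p) - enn2real (v x)\<bar> \<le> e / 2"
        using lim e by (meson half_gt_zero)
      have "(\<lambda>N. (d - c) * (1 / 2) ^ N) \<longlonglongrightarrow> (d - c) * 0"
        by (intro tendsto_intros LIMSEQ_power_zero) auto
      then have "\<forall>\<^sub>F N in sequentially. (d - c) * (1 / 2) ^ N < D"
        using D(1) by (intro order_tendstoD) auto
      then show "\<forall>\<^sub>F N in sequentially. dist (cell_average (\<lambda>c d. enn2real (mass v c d)) (dyadic_cell N c d x)) (enn2real (v x)) < e"
      proof eventually_elim
        fix N assume N: "(d - c) * (1 / 2) ^ N < D"
        obtain p q where pq: "dyadic_cell N c d x = (p, q)" by (cases "dyadic_cell N c d x")
        have *: "p \<le> x" "x \<le> q" "q - p = (d - c) / 2 ^ N"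
          using dyadic_cell_bounds[OF _ _ _ pq] cd by auto
        have "0 < q - p" unfolding *(3) using cd by simp
        moreover have "q - p < D" using N unfolding *(3) by (simp add: power_one_over)
        ultimately have "\<bar>enn2real (mass v p q) / (q - p) - enn2real (v x)\<bar> \<le> e / 2"
          using D(2)[OF *(1,2)] unfolding integral_unique[OF hi] by simp
        then show "dist (cell_average (\<lambda>c d. enn2real (mass v c d)) (dyadic_cell N c d x)) (enn2real (v x)) < e"
          using e by (simp add: pq cell_average_def dist_real_def)
      qed
    qed
  qed auto
qed

text \<open>Powers with positive exponent; the value at \<open>top\<close> is the limit.\<close>
definition ennreal_powr :: "ennreal \<Rightarrow> real \<Rightarrow> ennreal" where
  "ennreal_powr x r = (if x = top then top else ennreal (enn2real x powr r))"

lemma ennreal_powr_ennreal [simp]: "0 \<le> x \<Longrightarrow> ennreal_powr (ennreal x) r = ennreal (x powr r)"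
  by (simp add: ennreal_powr_def)

lemma ennreal_powr_0 [simp]: "ennreal_powr 0 r = 0"
  by (simp add: ennreal_powr_def)

lemma ennreal_powr_top [simp]: "ennreal_powr top r = top"
  by (simp add: ennreal_powr_def)

lemma measurable_ennreal_powr [measurable]:
  "f \<in> borel_measurable M \<Longrightarrow> (\<lambda>x. ennreal_powr (f x) r) \<in> borel_measurable M"
proof -
  assume [measurable]: "f \<in> borel_measurable M"
  have "{x \<in> space M. f x = top} = f -` {top} \<inter> space M" by auto
  also have "\<dots> \<in> sets M" by measurable
  finally show ?thesis unfolding ennreal_powr_def by (intro measurable_If) auto
qed

text \<open>
  In the case \<open>A < 1\<close> already the average over the interval itself, as a lower bound for the
  maximal function, shows that \<open>v\<close> vanishes almost everywhere.
\<close>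
theorem reverse_hoelder_interval:
  assumes v[measurable]: "v \<in> borel_measurable borel" and ab: "a < b"
    and supp: "\<And>x. v x \<noteq> 0 \<Longrightarrow> x \<in> {a..b}"
    and A: "dyadic_A_infty A (mass v) a b" "0 \<le> A" and r: "1 < r" "A < 1 \<or> 20 * A * (r - 1) \<le> 1"
  shows "(\<integral>\<^sup>+x. ennreal_powr (v x) r \<partial>lborel) \<le>
    ennreal (6 * (b - a) powr (1 - r)) * ennreal_powr (\<integral>\<^sup>+x. v x \<partial>lborel) r"
proof -
  have tot: "(\<integral>\<^sup>+x. v x \<partial>lborel) = mass v a b"
    unfolding mass_def using supp by (intro nn_integral_cong) (force simp: indicator_def)
  have le: "mass v c d \<le> mass v a b" for c d
    unfolding tot[symmetric] unfolding mass_def by (intro nn_integral_mono) (auto simp: indicator_def)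
  consider "mass v a b = top" | "mass v a b < top" "A < 1" | "mass v a b < top" "1 \<le> A"
    by (fastforce simp: less_top)
  then show ?thesis
  proof cases
    case 1
    then show ?thesis unfolding tot using ab by (simp add: ennreal_mult_top)
  next
    case 2
    have "mass v a b = dyadic_max 0 (mass v) 0 a b"
      using ab by (simp add: ennreal_divide_times max_absorb2 ennreal_times_divide mult_divide_eq_ennreal)
    also have "\<dots> \<le> ennreal A * mass v a b"
      using A(1) ab unfolding dyadic_A_infty_def by blast
    finally have "ennreal (enn2real (mass v a b)) \<le> ennreal (A * enn2real (mass v a b))"
      using 2 A(2) by (simp add: ennreal_mult)
    then have "enn2real (mass v a b) \<le> A * enn2real (mass v a b)"
      using A(2) by (subst (asm) ennreal_le_iff) auto
    then have "(1 - A) * enn2real (mass v a b) \<le> 0" by (simp add: algebra_simps)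
    then have "enn2real (mass v a b) = 0" using 2
      by (smt (verit) enn2real_nonneg mult_pos_pos)
    then have "mass v a b = 0" using 2 by (auto simp: enn2real_eq_0_iff)
    then have "AE x in lborel. v x = 0" unfolding tot[symmetric] by (simp add: nn_integral_0_iff_AE)
    then have "(\<integral>\<^sup>+x. ennreal_powr (v x) r \<partial>lborel) = (\<integral>\<^sup>+x. 0 \<partial>(lborel::real measure))"
      by (intro nn_integral_cong_AE) auto
    then show ?thesis by simp
  next
    case 3
    define F where "F = (\<lambda>c d. enn2real (mass v c d))"
    have fin: "mass v c d < top" for c d using le[of c d] 3(1) by (rule le_less_trans)
    have F: "interval_mass a b F" unfolding F_def by (rule interval_mass_mass[OF v 3(1)])
    have VF: "mass v = (\<lambda>c d. ennreal (F c d))" using fin by (auto simp: F_def less_top)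
    let ?f = "\<lambda>N x. ennreal (cell_average F (dyadic_cell N a b x) powr (1 + (r - 1))) * indicator {a<..b} x"
    have meas: "?f N \<in> borel_measurable lborel" for N
      using measurable_dyadic_cell[of "\<lambda>I. ennreal (cell_average F I powr (1 + (r - 1)))" N a b]
      by (intro borel_measurable_times_ennreal borel_measurable_indicator) (simp_all add: measurable_lborel1)
    have "AE x in lborel. x \<noteq> a" by (rule AE_lborel_singleton)
    with AE_dyadic_averages_converge[OF v fin]
    have "AE x in lborel. ennreal_powr (v x) r = liminf (\<lambda>N. ?f N x)"
    proof eventually_elim
      case (elim x)
      show ?case
      proof (cases "x \<in> {a<..b}")
        case True
        then have "(\<lambda>N. cell_average F (dyadic_cell N a b x)) \<longlonglongrightarrow> enn2real (v x)"
          using elim ab unfolding F_def by auto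
        moreover have "0 \<le> cell_average F (dyadic_cell N a b x)" for N
        proof -
          obtain p q where pq: "dyadic_cell N a b x = (p, q)" by (cases "dyadic_cell N a b x")
          then have "p \<le> q" using dyadic_cell_bounds[OF _ _ ab pq] True by auto
          then show ?thesis by (simp add: pq cell_average_def F_def)
        qed
        ultimately have "(\<lambda>N. ?f N x) \<longlonglongrightarrow> ennreal (enn2real (v x) powr (1 + (r - 1)))"
          using True r by (auto intro!: tendsto_intros tendsto_powr')
        moreover have "ennreal (enn2real (v x) powr (1 + (r - 1))) = ennreal_powr (v x) r"
          using elim by (auto simp: ennreal_powr_def)
        ultimately show ?thesis by (simp add: lim_imp_Liminf)
      next
        case False
        then have "v x = 0" using supp elim by force
        then show ?thesis using False by (simp add: Liminf_const)
      qed
    qed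
    then have "(\<integral>\<^sup>+x. ennreal_powr (v x) r \<partial>lborel) = (\<integral>\<^sup>+x. liminf (\<lambda>N. ?f N x) \<partial>lborel)"
      by (rule nn_integral_cong_AE)
    also have "\<dots> \<le> liminf (\<lambda>N. \<integral>\<^sup>+x. ?f N x \<partial>lborel)"
      by (rule nn_integral_liminf[OF meas])
    also have "\<dots> \<le> liminf (\<lambda>N::nat. ennreal (6 * F a b * (F a b / (b - a)) powr (r - 1)))"
    proof (intro Liminf_mono always_eventually allI)
      fix N
      have "(\<integral>\<^sup>+x. ?f N x \<partial>lborel) = ennreal (energy F (r - 1) N a b)"
        using energy_eq_nn_integral[OF F _ _ ab, of "r - 1" N] r by simp
      also have "\<dots> \<le> ennreal (6 * F a b * (F a b / (b - a)) powr (r - 1))"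
        using energy_bound[OF F A(1)[unfolded VF], of "r - 1" a b N] 3 r ab by (intro ennreal_leI) auto
      finally show "(\<integral>\<^sup>+x. ?f N x \<partial>lborel) \<le> \<dots>" .
    qed
    also have "\<dots> = ennreal (6 * F a b * (F a b / (b - a)) powr (r - 1))" by (simp add: Liminf_const)
    also have "6 * F a b * (F a b / (b - a)) powr (r - 1) = 6 * (b - a) powr (1 - r) * F a b powr r"
    proof -
      have "0 \<le> F a b" by (simp add: F_def)
      moreover have "F a b powr r = F a b * F a b powr (r - 1)" if "F a b > 0"
        using that by (simp add: powr_mult_base)
      moreover have "(b - a) powr (1 - r) = 1 / (b - a) powr (r - 1)"
        by (metis minus_diff_eq powr_minus_divide)
      ultimately show ?thesis using ab by (cases "F a b = 0") (auto simp: powr_divide)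
    qed
    also have "ennreal \<dots> = ennreal (6 * (b - a) powr (1 - r)) * ennreal_powr (mass v a b) r"
      using fin[of a b] by (simp add: ennreal_powr_def F_def ennreal_mult)
    finally show ?thesis unfolding tot .
  qed
qed

section \<open>The reverse Hoelder inequality on boxes\<close>

lemma dyadic_max_mono: "s \<le> s' \<Longrightarrow> dyadic_max N V s c d \<le> dyadic_max N V s' c d"
proof (induction N arbitrary: s s' c d)
  case 0
  then show ?case by (auto intro!: mult_right_mono max.mono)
next
  case (Suc N)
  have "max s (V c d / ennreal (d - c)) \<le> max s' (V c d / ennreal (d - c))"
    using Suc.prems by (intro max.mono) auto
  then show ?case by (auto intro!: add_mono Suc.IH)
qed

lemma dyadic_max_cong:
  assumes "\<And>p q. c \<le> p \<Longrightarrow> p < q \<Longrightarrow> q \<le> d \<Longrightarrow> V p q = V' p q" "c < d"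
  shows "dyadic_max N V s c d = dyadic_max N V' s c d"
  using assms
proof (induction N arbitrary: s c d)
  case (Suc N)
  have "V c d = V' c d" using Suc.prems by simp
  moreover have "dyadic_max N V s' c (mid c d) = dyadic_max N V' s' c (mid c d)"
    "dyadic_max N V s' (mid c d) d = dyadic_max N V' s' (mid c d) d" for s'
    using Suc.prems(2) by (intro Suc.IH Suc.prems(1); simp)+
  ultimately show ?case by simp
qed simp

lemma dyadic_A_infty_cong:
  assumes "\<And>p q. a \<le> p \<Longrightarrow> p < q \<Longrightarrow> q \<le> b \<Longrightarrow> V p q = V' p q" "dyadic_A_infty A V a b"
  shows "dyadic_A_infty A V' a b"
  unfolding dyadic_A_infty_def
proof (intro allI impI)
  fix N c d assume cd: "a \<le> c \<and> c < d \<and> d \<le> b"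
  have "dyadic_max N V' 0 c d = dyadic_max N V 0 c d"
    using cd by (intro dyadic_max_cong assms(1)[symmetric]) auto
  also have "\<dots> \<le> ennreal A * V c d" using assms(2) cd by (simp add: dyadic_A_infty_def)
  finally show "dyadic_max N V' 0 c d \<le> ennreal A * V' c d" using assms(1) cd by simp
qed

lemma dyadic_max_zero: "dyadic_max N (\<lambda>_ _. 0) 0 c d = 0"
  by (induction N arbitrary: c d) auto

lemma measurable_dyadic_max:
  assumes "\<And>c d. (\<lambda>y. V y c d) \<in> borel_measurable M" "s \<in> borel_measurable M"
  shows "(\<lambda>y. dyadic_max N (V y) (s y) c d) \<in> borel_measurable M"
  using assms(2)
proof (induction N arbitrary: s c d)
  case 0
  note [measurable] = assms(1) 0
  show ?case unfolding dyadic_max.simps by measurable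
next
  case (Suc N)
  note [measurable] = assms(1) Suc.prems
  show ?case unfolding dyadic_max.simps by (intro borel_measurable_add Suc.IH) measurable
qed

text \<open>
  Sublinearity of the maximal function for a continuum of summands. The running maximum has to be
  integrated along with the masses for the induction to go through.
\<close>
lemma dyadic_max_nn_integral_le:
  assumes V: "\<And>c d. (\<lambda>y. V y c d) \<in> borel_measurable M" and "s \<in> borel_measurable M"
  shows "dyadic_max N (\<lambda>c d. \<integral>\<^sup>+y. V y c d \<partial>M) (\<integral>\<^sup>+y. s y \<partial>M) c d
    \<le> (\<integral>\<^sup>+y. dyadic_max N (V y) (s y) c d \<partial>M)"
  using assms(2)
proof (induction N arbitrary: s c d)
  case 0
  note [measurable] = assms(1) 0
  have "max (\<integral>\<^sup>+y. s y \<partial>M) ((\<integral>\<^sup>+y. V y c d \<partial>M) / ennreal (d - c))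
      \<le> (\<integral>\<^sup>+y. max (s y) (V y c d / ennreal (d - c)) \<partial>M)"
    by (subst nn_integral_divide[symmetric]) (auto intro!: nn_integral_mono)
  then have "max (\<integral>\<^sup>+y. s y \<partial>M) ((\<integral>\<^sup>+y. V y c d \<partial>M) / ennreal (d - c)) * ennreal (d - c)
      \<le> (\<integral>\<^sup>+y. max (s y) (V y c d / ennreal (d - c)) \<partial>M) * ennreal (d - c)"
    by (rule mult_right_mono) simp
  also have "\<dots> = (\<integral>\<^sup>+y. max (s y) (V y c d / ennreal (d - c)) * ennreal (d - c) \<partial>M)"
    by (rule nn_integral_multc[symmetric]) measurable
  finally show ?case by simp
next
  case (Suc N)
  note [measurable] = assms(1) Suc.prems
  let ?s = "\<lambda>y. max (s y) (V y c d / ennreal (d - c))"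
  have le: "max (\<integral>\<^sup>+y. s y \<partial>M) ((\<integral>\<^sup>+y. V y c d \<partial>M) / ennreal (d - c)) \<le> (\<integral>\<^sup>+y. ?s y \<partial>M)"
    by (subst nn_integral_divide[symmetric]) (auto intro!: nn_integral_mono)
  have half: "dyadic_max N (\<lambda>c d. \<integral>\<^sup>+y. V y c d \<partial>M)
        (max (\<integral>\<^sup>+y. s y \<partial>M) ((\<integral>\<^sup>+y. V y c d \<partial>M) / ennreal (d - c))) p q
      \<le> (\<integral>\<^sup>+y. dyadic_max N (V y) (?s y) p q \<partial>M)" for p q
    by (rule order_trans[OF dyadic_max_mono[OF le]]) (intro Suc.IH, measurable)
  show ?case unfolding dyadic_max.simps
    by (subst nn_integral_add) (auto intro!: add_mono half measurable_dyadic_max V)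
qed

text \<open>
  The dyadic maximal function as a step function below a given majorant \<open>M\<close> of all averages. Exhibiting
  the step function avoids splitting an integral of \<open>M\<close>, which may fail to be measurable.
\<close>
lemma dyadic_max_step_function:
  assumes "c < d" "\<And>x. x \<in> {c<..d} \<Longrightarrow> s \<le> M x"
    and "\<And>p q x. c \<le> p \<Longrightarrow> p < q \<Longrightarrow> q \<le> d \<Longrightarrow> x \<in> {p..q} \<Longrightarrow> V p q / ennreal (q - p) \<le> M x"
  shows "\<exists>f\<in>borel_measurable lborel. (\<forall>x. f x \<le> M x * indicator {c<..d} x) \<and>
    (\<integral>\<^sup>+x. f x \<partial>lborel) = dyadic_max N V s c d"
  using assms
proof (induction N arbitrary: s c d)
  case 0
  let ?t = "max s (V c d / ennreal (d - c))"
  have "?t \<le> M x" if "x \<in> {c<..d}" for x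
    using 0(2)[of x] 0(3)[of c d x] that 0(1) by auto
  then show ?case using 0(1)
    by (intro bexI[of _ "\<lambda>x. ?t * indicator {c<..d} x"] conjI allI)
      (simp_all add: nn_integral_cmult split: split_indicator)
next
  case (Suc N)
  let ?t = "max s (V c d / ennreal (d - c))"
  have t: "?t \<le> M x" if "x \<in> {c<..d}" for x
    using Suc.prems(2)[of x] Suc.prems(3)[of c d x] that Suc.prems(1) by auto
  have "\<exists>f\<in>borel_measurable lborel. (\<forall>x. f x \<le> M x * indicator {c<..mid c d} x) \<and>
    (\<integral>\<^sup>+x. f x \<partial>lborel) = dyadic_max N V ?t c (mid c d)"
    using Suc.prems(1) t by (intro Suc.IH Suc.prems(3)) auto
  then obtain f1 where f1: "f1 \<in> borel_measurable lborel" "\<And>x. f1 x \<le> M x * indicator {c<..mid c d} x"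
    "(\<integral>\<^sup>+x. f1 x \<partial>lborel) = dyadic_max N V ?t c (mid c d)" by blast
  have "\<exists>f\<in>borel_measurable lborel. (\<forall>x. f x \<le> M x * indicator {mid c d<..d} x) \<and>
    (\<integral>\<^sup>+x. f x \<partial>lborel) = dyadic_max N V ?t (mid c d) d"
    using Suc.prems(1) t by (intro Suc.IH Suc.prems(3)) auto
  then obtain f2 where f2: "f2 \<in> borel_measurable lborel" "\<And>x. f2 x \<le> M x * indicator {mid c d<..d} x"
    "(\<integral>\<^sup>+x. f2 x \<partial>lborel) = dyadic_max N V ?t (mid c d) d" by blast
  have "f1 x + f2 x \<le> M x * indicator {c<..d} x" for x
    using f1(2)[of x] f2(2)[of x] Suc.prems(1)
    by (cases "x \<le> mid c d"; cases "x \<in> {c<..d}") (auto split: split_indicator_asm)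
  moreover have "(\<integral>\<^sup>+x. f1 x + f2 x \<partial>lborel) = dyadic_max (Suc N) V s c d"
    using f1 f2 by (subst nn_integral_add) auto
  ultimately show ?case using f1(1) f2(1) by (intro bexI[of _ "\<lambda>x. f1 x + f2 x"]) auto
qed

interpretation lborel_prod: product_sigma_finite "\<lambda>_::nat. lborel :: real measure"
  by standard

abbreviation lborel_on :: "nat set \<Rightarrow> (nat \<Rightarrow> real) measure" where
  "lborel_on I \<equiv> Pi\<^sub>M I (\<lambda>_. lborel)"

lemma measurable_update_lborel_on:
  assumes "x \<in> space (lborel_on I)"
  shows "(\<lambda>t. x(i := t)) \<in> borel \<rightarrow>\<^sub>M lborel_on (insert i I)"
proof -
  have "(\<lambda>t. x(i := t)) \<in> lborel \<rightarrow>\<^sub>M lborel_on (insert i I)"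
    using assms by (intro measurable_fun_upd[where J = I]) auto
  then show ?thesis by simp
qed

lemma measurable_line:
  assumes "f \<in> borel_measurable (lborel_on (insert i I))" "x \<in> space (lborel_on I)"
  shows "(\<lambda>t. f (x(i := t))) \<in> borel_measurable borel"
  using measurable_compose[OF measurable_update_lborel_on[OF assms(2)] assms(1)] .

lemma measurable_update_pair:
  "(\<lambda>z. (fst z)(i := snd z)) \<in> lborel_on I \<Otimes>\<^sub>M lborel \<rightarrow>\<^sub>M lborel_on (insert i I)"
  by (intro measurable_fun_upd[where J = I]) auto

lemma measurable_mass_line:
  assumes f: "f \<in> borel_measurable (lborel_on (insert i I))"
  shows "(\<lambda>x. mass (\<lambda>t. f (x(i := t))) c d) \<in> borel_measurable (lborel_on I)"
proof -
  note [measurable] = measurable_compose[OF measurable_update_pair f]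
  have "(\<lambda>z. f ((fst z)(i := snd z)) * indicator {c..d} (snd z)) \<in> borel_measurable (lborel_on I \<Otimes>\<^sub>M lborel)"
    by measurable
  from lborel.borel_measurable_nn_integral_fst[OF this]
  show ?thesis unfolding mass_def by simp
qed

lemma measurable_integral_line:
  assumes f: "f \<in> borel_measurable (lborel_on (insert i I))"
  shows "(\<lambda>x. \<integral>\<^sup>+t. f (x(i := t)) \<partial>lborel) \<in> borel_measurable (lborel_on I)"
proof -
  from lborel.borel_measurable_nn_integral_fst[OF measurable_compose[OF measurable_update_pair f]]
  show ?thesis by simp
qed

lemma AE_lborel_on_insertD:
  assumes "finite I" "i \<notin> I" "AE y in lborel_on (insert i I). P y"
  shows "AE x in lborel_on I. AE t in lborel. P (x(i := t))"
proof -
  obtain N where N: "N \<in> null_sets (lborel_on (insert i I))" "{y \<in> space (lborel_on (insert i I)). \<not> P y} \<subseteq> N"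
    using assms(3) unfolding eventually_ae_filter by auto
  have m: "indicator N \<in> borel_measurable (lborel_on (insert i I))" using N(1) by auto
  have "0 = (\<integral>\<^sup>+y. indicator N y \<partial>lborel_on (insert i I))"
    using N(1) by (simp add: null_setsD1 null_setsD2)
  also have "\<dots> = (\<integral>\<^sup>+x. \<integral>\<^sup>+t. indicator N (x(i := t)) \<partial>lborel \<partial>lborel_on I)"
    using assms(1,2) m by (rule lborel_prod.product_nn_integral_insert)
  finally have "AE x in lborel_on I. (\<integral>\<^sup>+t. indicator N (x(i := t)) \<partial>lborel) = (0::ennreal)"
    by (subst (asm) eq_commute, subst (asm) nn_integral_0_iff_AE) (auto intro: measurable_integral_line[OF m])
  moreover have "AE x in lborel_on I. x \<in> space (lborel_on I)" by (rule AE_space)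
  ultimately show ?thesis
  proof eventually_elim
    case (elim x)
    have "AE t in lborel. indicator N (x(i := t)) = (0::ennreal)"
      using elim measurable_line[OF m elim(2)] by (subst (asm) nn_integral_0_iff_AE) auto
    then show ?case
    proof eventually_elim
      fix t assume t: "indicator N (x(i := t)) = (0::ennreal)"
      have "x(i := t) \<in> space (lborel_on (insert i I))"
        using measurable_space[OF measurable_update_lborel_on[OF elim(2)], of t] by simp
      then show "P (x(i := t))" using t N(2) by (auto simp: indicator_eq_0_iff)
    qed
  qed
qed

lemma AE_lborel_on_insertI:
  assumes "finite I" "i \<notin> I" and P: "Measurable.pred (lborel_on (insert i I)) P"
    and "AE x in lborel_on I. AE t in lborel. P (x(i := t))"
  shows "AE y in lborel_on (insert i I). P y"
proof -
  let ?N = "{y \<in> space (lborel_on (insert i I)). \<not> P y}"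
  have N: "?N \<in> sets (lborel_on (insert i I))" using P by measurable
  then have m: "indicator ?N \<in> borel_measurable (lborel_on (insert i I))" by auto
  have "(\<integral>\<^sup>+y. indicator ?N y \<partial>lborel_on (insert i I)) =
      (\<integral>\<^sup>+x. \<integral>\<^sup>+t. indicator ?N (x(i := t)) \<partial>lborel \<partial>lborel_on I)"
    using assms(1,2) m by (rule lborel_prod.product_nn_integral_insert)
  also have "\<dots> = (\<integral>\<^sup>+x. 0 \<partial>lborel_on I)"
  proof (rule nn_integral_cong_AE)
    show "AE x in lborel_on I. (\<integral>\<^sup>+t. indicator ?N (x(i := t)) \<partial>lborel) = (0::ennreal)"
      using assms(4)
    proof eventually_elim
      case (elim x)
      then have "(\<integral>\<^sup>+t. indicator ?N (x(i := t)) \<partial>lborel) = (\<integral>\<^sup>+t. 0 \<partial>(lborel::real measure))"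
        by (intro nn_integral_cong_AE) (auto elim!: eventually_mono)
      then show ?case by simp
    qed
  qed
  finally have "?N \<in> null_sets (lborel_on (insert i I))" using N by (intro null_setsI) auto
  then show ?thesis by (rule AE_I') auto
qed

text \<open>Mixtures of weights with a common constant have that constant too, by sublinearity.\<close>
lemma dyadic_A_infty_integral:
  assumes V: "\<And>c d. (\<lambda>y. V y c d) \<in> borel_measurable M" and A: "AE y in M. dyadic_A_infty A (V y) a b"
  shows "dyadic_A_infty A (\<lambda>c d. \<integral>\<^sup>+y. V y c d \<partial>M) a b"
  unfolding dyadic_A_infty_def
proof (intro allI impI)
  fix N c d assume cd: "a \<le> c \<and> c < d \<and> d \<le> b"
  have "dyadic_max N (\<lambda>c d. \<integral>\<^sup>+y. V y c d \<partial>M) 0 c d \<le> (\<integral>\<^sup>+y. dyadic_max N (V y) 0 c d \<partial>M)"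
    using dyadic_max_nn_integral_le[where V = V and s = "\<lambda>_. 0" and N = N and c = c and d = d, OF V] by simp
  also have "\<dots> \<le> (\<integral>\<^sup>+y. ennreal A * V y c d \<partial>M)"
    using A cd by (intro nn_integral_mono_AE) (auto elim!: eventually_mono simp: dyadic_A_infty_def)
  also have "\<dots> = ennreal A * (\<integral>\<^sup>+y. V y c d \<partial>M)"
    by (rule nn_integral_cmult[OF V])
  finally show "dyadic_max N (\<lambda>c d. \<integral>\<^sup>+y. V y c d \<partial>M) 0 c d \<le> ennreal A * (\<integral>\<^sup>+y. V y c d \<partial>M)" .
qed

text \<open>
  Induction on the set of coordinates. Integrating out one coordinate \<open>i\<close> leaves a function \<open>g\<close> of the
  others that satisfies the hypotheses again: its restriction to a line is a mixture of restrictions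
  of \<open>f\<close>. The interval inequality in the direction \<open>i\<close> bounds the integral of $f^r$ by that
  of $g^r$.
\<close>
theorem reverse_hoelder_box:
  assumes "finite I" and f: "f \<in> borel_measurable (lborel_on I)" and ab: "\<And>i. i \<in> I \<Longrightarrow> a i < b i"
    and supp: "\<And>x i. x \<in> space (lborel_on I) \<Longrightarrow> f x \<noteq> 0 \<Longrightarrow> i \<in> I \<Longrightarrow> x i \<in> {a i..b i}"
    and A: "\<And>j. j \<in> I \<Longrightarrow>
      AE x in lborel_on (I - {j}). dyadic_A_infty A (mass (\<lambda>t. f (x(j := t)))) (a j) (b j)" "0 \<le> A"
    and r: "1 < r" "A < 1 \<or> 20 * A * (r - 1) \<le> 1"
  shows "(\<integral>\<^sup>+x. ennreal_powr (f x) r \<partial>lborel_on I) \<le>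
    ennreal (\<Prod>i\<in>I. 6 * (b i - a i) powr (1 - r)) * ennreal_powr (\<integral>\<^sup>+x. f x \<partial>lborel_on I) r"
  using assms(1-5)
proof (induction I arbitrary: f)
  case empty
  then show ?case by (simp add: lborel_prod.nn_integral_empty)
next
  case (insert i I)
  note f = insert.prems(1) and supp = insert.prems(3) and A' = insert.prems(4)
  define g where "g = (\<lambda>x. \<integral>\<^sup>+t. f (x(i := t)) \<partial>lborel)"
  have g: "g \<in> borel_measurable (lborel_on I)" unfolding g_def by (rule measurable_integral_line[OF f])
  have upd: "x(i := t) \<in> space (lborel_on (insert i I))" if "x \<in> space (lborel_on I)" for x t
    using measurable_space[OF measurable_update_lborel_on[OF that], of t] by simp
  let ?k = "6 * (b i - a i) powr (1 - r)"
  have IH: "(\<integral>\<^sup>+x. ennreal_powr (g x) r \<partial>lborel_on I) \<le>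
    ennreal (\<Prod>i\<in>I. 6 * (b i - a i) powr (1 - r)) * ennreal_powr (\<integral>\<^sup>+x. g x \<partial>lborel_on I) r"
  proof (rule insert.IH[OF g])
    fix x k assume x: "x \<in> space (lborel_on I)" "g x \<noteq> 0" "k \<in> I"
    have "\<exists>t. f (x(i := t)) \<noteq> 0"
    proof (rule ccontr)
      assume "\<not> (\<exists>t. f (x(i := t)) \<noteq> 0)"
      then have "g x = 0" by (simp add: g_def)
      with x(2) show False by simp
    qed
    then obtain t where "f (x(i := t)) \<noteq> 0" by blast
    from supp[OF upd[OF x(1)] this, of k] x(3) insert.hyps(2) show "x k \<in> {a k..b k}"
      by (auto split: if_splits)
  next
    fix j assume j: "j \<in> I"
    have ji: "i \<noteq> j" using j insert.hyps by auto
    have ins: "insert i I - {j} = insert i (I - {j})" using ji by auto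
    have "AE y in lborel_on (insert i (I - {j})). dyadic_A_infty A (mass (\<lambda>t. f (y(j := t)))) (a j) (b j)"
      using A'[OF insertI2[OF j]] unfolding ins .
    then have "AE x in lborel_on (I - {j}). AE s in lborel.
        dyadic_A_infty A (mass (\<lambda>t. f (x(i := s, j := t)))) (a j) (b j)"
      by (rule AE_lborel_on_insertD[rotated 2]) (use insert.hyps in auto)
    moreover have "AE x in lborel_on (I - {j}). x \<in> space (lborel_on (I - {j}))" by (rule AE_space)
    ultimately show "AE x in lborel_on (I - {j}). dyadic_A_infty A (mass (\<lambda>t. g (x(j := t)))) (a j) (b j)"
    proof eventually_elim
      case (elim x)
      have "(\<lambda>z. x(i := fst z, j := snd z)) \<in> lborel \<Otimes>\<^sub>M lborel \<rightarrow>\<^sub>M lborel_on (insert i I)"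
      proof (rule measurable_fun_upd[where J = "insert i (I - {j})"])
        show "insert i I = insert i (I - {j}) \<union> {j}" using j by auto
        show "(\<lambda>z. x(i := fst z)) \<in> lborel \<Otimes>\<^sub>M lborel \<rightarrow>\<^sub>M lborel_on (insert i (I - {j}))"
          using elim(2) by (intro measurable_fun_upd[where J = "I - {j}"]) auto
      qed simp
      from measurable_compose[OF this f]
      have m[measurable]: "(\<lambda>z. f (x(i := fst z, j := snd z))) \<in> borel_measurable (lborel \<Otimes>\<^sub>M lborel)" .
      have meas: "(\<lambda>s. mass (\<lambda>t. f (x(i := s, j := t))) c d) \<in> borel_measurable lborel" for c d
      proof -
        have "(\<lambda>z. f (x(i := fst z, j := snd z)) * indicator {c..d} (snd z)) \<in> borel_measurable (lborel \<Otimes>\<^sub>M lborel)"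
          by measurable
        from lborel.borel_measurable_nn_integral_fst[OF this] show ?thesis unfolding mass_def by simp
      qed
      have "mass (\<lambda>t. g (x(j := t))) c d = (\<integral>\<^sup>+s. mass (\<lambda>t. f (x(i := s, j := t))) c d \<partial>lborel)" for c d
      proof -
        have "mass (\<lambda>t. g (x(j := t))) c d = (\<integral>\<^sup>+t. \<integral>\<^sup>+s. f (x(i := s, j := t)) * indicator {c..d} t \<partial>lborel \<partial>lborel)"
          unfolding mass_def g_def
        proof (rule nn_integral_cong)
          fix t :: real
          have "(\<lambda>z. f (x(i := fst (z, t), j := snd (z, t)))) \<in> borel_measurable lborel"
            by (rule measurable_compose[OF _ m]) measurable
          then show "(\<integral>\<^sup>+s. f (x(j := t, i := s)) \<partial>lborel) * indicator {c..d} t =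
              (\<integral>\<^sup>+s. f (x(i := s, j := t)) * indicator {c..d} t \<partial>lborel)"
            by (subst nn_integral_multc) (auto simp: fun_upd_twist[OF ji])
        qed
        also have "\<dots> = (\<integral>\<^sup>+s. \<integral>\<^sup>+t. f (x(i := s, j := t)) * indicator {c..d} t \<partial>lborel \<partial>lborel)"
        proof (rule lborel_pair.Fubini')
          have "(\<lambda>z. f (x(i := fst z, j := snd z)) * indicator {c..d} (snd z)) \<in> borel_measurable (lborel \<Otimes>\<^sub>M lborel)"
            by measurable
          then show "(\<lambda>(s, t). f (x(i := s, j := t)) * indicator {c..d} t) \<in> borel_measurable (lborel \<Otimes>\<^sub>M lborel)"
            by (simp add: case_prod_beta')
        qed
        finally show ?thesis by (simp add: mass_def)
      qed
      then have "mass (\<lambda>t. g (x(j := t))) = (\<lambda>c d. \<integral>\<^sup>+s. mass (\<lambda>t. f (x(i := s, j := t))) c d \<partial>lborel)"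
        by blast
      then show ?case using dyadic_A_infty_integral[OF meas elim(1)] by simp
    qed
  qed (use insert.prems in auto)
  have "(\<integral>\<^sup>+x. ennreal_powr (f x) r \<partial>lborel_on (insert i I)) =
      (\<integral>\<^sup>+x. \<integral>\<^sup>+t. ennreal_powr (f (x(i := t))) r \<partial>lborel \<partial>lborel_on I)"
    using insert.hyps f by (intro lborel_prod.product_nn_integral_insert) auto
  also have "\<dots> \<le> (\<integral>\<^sup>+x. ennreal ?k * ennreal_powr (g x) r \<partial>lborel_on I)"
  proof (rule nn_integral_mono_AE)
    have rem: "insert i I - {i} = I" using insert.hyps by auto
    have "AE x in lborel_on I. dyadic_A_infty A (mass (\<lambda>t. f (x(i := t)))) (a i) (b i)"
      using A'[OF insertI1] unfolding rem .
    moreover have "AE x in lborel_on I. x \<in> space (lborel_on I)" by (rule AE_space)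
    ultimately show "AE x in lborel_on I. (\<integral>\<^sup>+t. ennreal_powr (f (x(i := t))) r \<partial>lborel)
        \<le> ennreal ?k * ennreal_powr (g x) r"
    proof eventually_elim
      case (elim x)
      show ?case unfolding g_def
      proof (rule reverse_hoelder_interval[OF _ _ _ elim(1) A(2) r])
        show "(\<lambda>t. f (x(i := t))) \<in> borel_measurable borel" by (rule measurable_line[OF f elim(2)])
        show "a i < b i" using insert.prems(2) by simp
        show "t \<in> {a i..b i}" if "f (x(i := t)) \<noteq> 0" for t
          using supp[OF upd[OF elim(2)] that, of i] by simp
      qed
    qed
  qed
  also have "\<dots> = ennreal ?k * (\<integral>\<^sup>+x. ennreal_powr (g x) r \<partial>lborel_on I)"
    by (intro nn_integral_cmult measurable_ennreal_powr g)
  also have "\<dots> \<le> ennreal ?k * (ennreal (\<Prod>i\<in>I. 6 * (b i - a i) powr (1 - r)) *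
      ennreal_powr (\<integral>\<^sup>+x. g x \<partial>lborel_on I) r)"
    by (intro mult_left_mono IH) simp
  also have "(\<integral>\<^sup>+x. g x \<partial>lborel_on I) = (\<integral>\<^sup>+x. f x \<partial>lborel_on (insert i I))"
    unfolding g_def using insert.hyps f by (intro lborel_prod.product_nn_integral_insert[symmetric]) auto
  also have "ennreal ?k * (ennreal (\<Prod>i\<in>I. 6 * (b i - a i) powr (1 - r)) * X)
    = ennreal (\<Prod>i\<in>insert i I. 6 * (b i - a i) powr (1 - r)) * X" for X
    using insert.hyps by (simp add: ennreal_mult prod_nonneg mult.assoc)
  finally show ?case .
qed

section \<open>From boxes to points by differentiation\<close>

lemma dyadic_cell_rational:
  assumes "c \<in> \<rat>" "d \<in> \<rat>" "dyadic_cell N c d x = (p, q)"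
  shows "p \<in> \<rat> \<and> q \<in> \<rat>"
  using assms
proof (induction N arbitrary: c d)
  case (Suc N)
  have m: "mid c d \<in> \<rat>" using Suc.prems by (intro Rats_divide Rats_add) auto
  show ?case
    using Suc.prems Suc.IH[OF Suc.prems(1) m] Suc.IH[OF m Suc.prems(2)]
    by (cases "x \<le> mid c d") simp_all
qed simp

lemma mass_mono: "a \<le> c \<Longrightarrow> d \<le> b \<Longrightarrow> mass v c d \<le> mass v a b"
  unfolding mass_def by (intro nn_integral_mono) (auto simp: indicator_def)

lemma mass_finite_if_rational:
  assumes "\<And>p q. p \<in> \<rat> \<Longrightarrow> q \<in> \<rat> \<Longrightarrow> p < q \<Longrightarrow> mass f p q < top"
  shows "mass f a b < top"
proof -
  obtain n :: nat where n: "max \<bar>a\<bar> \<bar>b\<bar> + 1 \<le> real n" using real_arch_simple by blast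
  have "mass f a b \<le> mass f (- real n) (real n)" using n by (intro mass_mono) auto
  also have "\<dots> < top" using n by (intro assms) auto
  finally show ?thesis .
qed

lemma AE_le_of_rational_intervals:
  assumes g: "g \<in> borel_measurable borel" and h: "h \<in> borel_measurable borel"
    and k: "0 \<le> k" and r: "1 < r"
    and fin: "\<And>p q. p \<in> \<rat> \<Longrightarrow> q \<in> \<rat> \<Longrightarrow> p < q \<Longrightarrow> mass h p q < top"
    and le: "\<And>p q. p \<in> \<rat> \<Longrightarrow> q \<in> \<rat> \<Longrightarrow> p < q \<Longrightarrow>
      mass g p q \<le> ennreal (k * (q - p) powr (1 - r)) * ennreal_powr (mass h p q) r"
  shows "AE t in lborel. g t \<le> ennreal k * ennreal_powr (h t) r \<and> h t < top"
proof -
  have fing: "mass g p q < top" if "p \<in> \<rat>" "q \<in> \<rat>" "p < q" for p q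
    using le[OF that] fin[OF that] by (auto simp: ennreal_powr_def ennreal_mult_less_top less_top intro: le_less_trans)
  have hf: "mass h a b < top" for a b by (rule mass_finite_if_rational[OF fin])
  have gf: "mass g a b < top" for a b by (rule mass_finite_if_rational[OF fing])
  from AE_dyadic_averages_converge[OF g gf] AE_dyadic_averages_converge[OF h hf]
  show ?thesis
  proof eventually_elim
    case (elim x)
    obtain n :: nat where n: "\<bar>x\<bar> + 1 \<le> real n" using real_arch_simple by blast
    let ?c = "- real n" and ?d = "real n"
    let ?G = "\<lambda>N. cell_average (\<lambda>c d. enn2real (mass g c d)) (dyadic_cell N ?c ?d x)"
    let ?H = "\<lambda>N. cell_average (\<lambda>c d. enn2real (mass h c d)) (dyadic_cell N ?c ?d x)"
    have lim: "?G \<longlonglongrightarrow> enn2real (g x)" "?H \<longlonglongrightarrow> enn2real (h x)"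
    proof -
      have "?c \<le> x \<and> x \<le> ?d \<and> ?c < ?d" using n by linarith
      then show "?G \<longlonglongrightarrow> enn2real (g x)" "?H \<longlonglongrightarrow> enn2real (h x)" using elim by blast+
    qed
    have *: "?G N \<le> k * ?H N powr r \<and> 0 \<le> ?H N" for N
    proof -
      obtain p q where pq: "dyadic_cell N ?c ?d x = (p, q)" by (cases "dyadic_cell N ?c ?d x")
      have "q - p = (?d - ?c) / 2 ^ N"
        using dyadic_cell_bounds[OF _ _ _ pq] n by auto
      also have "\<dots> > 0" using n by simp
      finally have lt: "0 < q - p" .
      have rat: "p \<in> \<rat>" "q \<in> \<rat>" using dyadic_cell_rational[OF _ _ pq] by auto
      define X where "X = enn2real (mass g p q)"
      define Y where "Y = enn2real (mass h p q)"
      have "ennreal X \<le> ennreal (k * (q - p) powr (1 - r)) * ennreal_powr (ennreal Y) r"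
        using le[OF rat] lt gf[of p q] hf[of p q] by (simp add: X_def Y_def less_top)
      also have "\<dots> = ennreal (k * (q - p) powr (1 - r) * Y powr r)"
        using k by (simp add: Y_def ennreal_mult)
      finally have "X \<le> k * (q - p) powr (1 - r) * Y powr r"
        using k by (simp add: ennreal_le_iff)
      then have "X / (q - p) \<le> k * (q - p) powr (1 - r) * Y powr r / (q - p)"
        using lt by (intro divide_right_mono) auto
      also have "(q - p) powr (1 - r) = (q - p) / (q - p) powr r"
        using lt by (simp add: powr_diff)
      finally have "X / (q - p) \<le> k * (Y / (q - p)) powr r"
        using lt by (simp add: powr_divide Y_def)
      then show ?thesis using lt by (simp add: pq cell_average_def X_def Y_def)
    qed
    have "(\<lambda>N. k * ?H N powr r) \<longlonglongrightarrow> k * enn2real (h x) powr r"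
      using * r by (intro tendsto_intros tendsto_powr' lim(2)) auto
    then have "enn2real (g x) \<le> k * enn2real (h x) powr r"
      using * by (intro LIMSEQ_le[OF lim(1)]) auto
    then have "ennreal (enn2real (g x)) \<le> ennreal (k * enn2real (h x) powr r)" by (rule ennreal_leI)
    moreover have "g x = ennreal (enn2real (g x))" "h x \<noteq> top" using elim by auto
    ultimately show ?case using elim k by (simp add: ennreal_mult ennreal_powr_def)
  qed
qed

abbreviation box_on :: "nat set \<Rightarrow> (nat \<Rightarrow> real) \<Rightarrow> (nat \<Rightarrow> real) \<Rightarrow> (nat \<Rightarrow> real) set" where
  "box_on I a b \<equiv> (\<Pi>\<^sub>E i\<in>I. {a i..b i})"

lemma nn_integral_box_insert:
  assumes "finite I" "i \<notin> I" and f: "f \<in> borel_measurable (lborel_on (insert i I))"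
  shows "(\<integral>\<^sup>+y\<in>box_on (insert i I) a b. f y \<partial>lborel_on (insert i I)) =
    (\<integral>\<^sup>+x\<in>box_on I a b. mass (\<lambda>t. f (x(i := t))) (a i) (b i) \<partial>lborel_on I)"
proof -
  have box: "box_on (insert i I) a b \<in> sets (lborel_on (insert i I))"
    using assms by (intro sets_PiM_I_finite) auto
  have "(\<integral>\<^sup>+y\<in>box_on (insert i I) a b. f y \<partial>lborel_on (insert i I)) =
    (\<integral>\<^sup>+x. \<integral>\<^sup>+t. f (x(i := t)) * indicator (box_on (insert i I) a b) (x(i := t)) \<partial>lborel \<partial>lborel_on I)"
    using assms box by (intro lborel_prod.product_nn_integral_insert) auto
  also have "\<dots> = (\<integral>\<^sup>+x\<in>box_on I a b. mass (\<lambda>t. f (x(i := t))) (a i) (b i) \<partial>lborel_on I)"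
  proof (rule nn_integral_cong)
    fix x assume x: "x \<in> space (lborel_on I)"
    then have xi: "x \<in> extensional I" by (simp add: space_PiM PiE_iff)
    have ind: "indicator (box_on (insert i I) a b) (x(i := t)) =
        (indicator (box_on I a b) x * indicator {a i..b i} t :: ennreal)" for t
    proof -
      have "x(i := t) \<in> box_on (insert i I) a b \<longleftrightarrow> x \<in> box_on I a b \<and> t \<in> {a i..b i}"
        using xi assms(2) by (auto simp: PiE_iff extensional_def)
      then show ?thesis by (auto simp: indicator_def)
    qed
    have m: "(\<lambda>t. f (x(i := t)) * indicator {a i..b i} t) \<in> borel_measurable lborel"
      using measurable_line[OF f x] by measurable
    have "(\<integral>\<^sup>+t. f (x(i := t)) * indicator (box_on (insert i I) a b) (x(i := t)) \<partial>lborel) =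
      (\<integral>\<^sup>+t. f (x(i := t)) * indicator {a i..b i} t * indicator (box_on I a b) x \<partial>lborel)"
      unfolding ind by (simp add: mult_ac)
    also have "\<dots> = mass (\<lambda>t. f (x(i := t))) (a i) (b i) * indicator (box_on I a b) x"
      unfolding mass_def by (rule nn_integral_multc[OF m])
    finally show "(\<integral>\<^sup>+t. f (x(i := t)) * indicator (box_on (insert i I) a b) (x(i := t)) \<partial>lborel) = \<dots>" .
  qed
  finally show ?thesis .
qed

text \<open>
  Differentiation in several variables, one coordinate at a time. For a fixed rational interval in
  the direction \<open>i\<close> the integrals over that interval satisfy the hypothesis in the remaining
  coordinates; there are countably many such intervals, so almost every line in the direction \<open>i\<close>
  satisfies the one-dimensional hypothesis on all of them. The factor $|Q|^{1-r}$ is multiplicative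
  in the sides of the box, which lets it be absorbed into the constant \<open>k\<close>.
\<close>
theorem AE_le_of_rational_boxes:
  assumes "finite S" "G \<in> borel_measurable (lborel_on S)" "H \<in> borel_measurable (lborel_on S)"
    and "0 \<le> k" and r: "1 < r"
    and "\<And>a b. (\<forall>i\<in>S. a i \<in> \<rat> \<and> b i \<in> \<rat> \<and> a i < b i) \<Longrightarrow>
      (\<integral>\<^sup>+x\<in>box_on S a b. H x \<partial>lborel_on S) < top \<and>
      (\<integral>\<^sup>+x\<in>box_on S a b. G x \<partial>lborel_on S) \<le>
        ennreal (k * (\<Prod>i\<in>S. b i - a i) powr (1 - r)) *
        ennreal_powr (\<integral>\<^sup>+x\<in>box_on S a b. H x \<partial>lborel_on S) r"
  shows "AE x in lborel_on S. G x \<le> ennreal k * ennreal_powr (H x) r \<and> H x < top"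
  using assms(1-4,6)
proof (induction S arbitrary: G H k)
  case empty
  have "(\<integral>\<^sup>+x\<in>box_on {} a b. F x \<partial>lborel_on {}) = F (\<lambda>_. undefined)" for a b :: "nat \<Rightarrow> real" and F
    by (subst lborel_prod.nn_integral_empty) auto
  with empty.prems(4)[of "\<lambda>_. 0" "\<lambda>_. 1"]
  have "G (\<lambda>_. undefined) \<le> ennreal k * ennreal_powr (H (\<lambda>_. undefined)) r \<and> H (\<lambda>_. undefined) < top"
    by simp
  then show ?case by (intro AE_I2) (auto simp: space_PiM)
next
  case (insert i S)
  note G = insert.prems(1) and H = insert.prems(2) and k = insert.prems(3)
  have "AE x in lborel_on S. \<forall>p\<in>\<rat>. \<forall>q\<in>\<rat>. p < q \<longrightarrow>
      mass (\<lambda>t. G (x(i := t))) p q \<le> ennreal (k * (q - p) powr (1 - r)) *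
        ennreal_powr (mass (\<lambda>t. H (x(i := t))) p q) r \<and> mass (\<lambda>t. H (x(i := t))) p q < top"
  proof (intro AE_ball_countable[THEN iffD2] countable_rat ballI AE_impI)
    fix p q :: real assume pq: "p \<in> \<rat>" "q \<in> \<rat>" "p < q"
    show "AE x in lborel_on S. mass (\<lambda>t. G (x(i := t))) p q \<le> ennreal (k * (q - p) powr (1 - r)) *
        ennreal_powr (mass (\<lambda>t. H (x(i := t))) p q) r \<and> mass (\<lambda>t. H (x(i := t))) p q < top"
    proof (rule insert.IH[OF measurable_mass_line[OF G] measurable_mass_line[OF H]])
      fix a b :: "nat \<Rightarrow> real" assume ab: "\<forall>i\<in>S. a i \<in> \<rat> \<and> b i \<in> \<rat> \<and> a i < b i"
      let ?a = "a(i := p)" and ?b = "b(i := q)"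
      have box: "box_on S ?a ?b = box_on S a b" using insert.hyps by (intro PiE_cong) auto
      have prod: "(\<Prod>j\<in>insert i S. ?b j - ?a j) = (q - p) * (\<Prod>j\<in>S. b j - a j)"
      proof -
        have "(\<Prod>j\<in>S. ?b j - ?a j) = (\<Prod>j\<in>S. b j - a j)"
          using insert.hyps by (intro prod.cong) auto
        then show ?thesis using insert.hyps by simp
      qed
      have "0 \<le> (\<Prod>j\<in>S. b j - a j)" using ab by (intro prod_nonneg) auto
      then have pw: "k * ((q - p) * (\<Prod>j\<in>S. b j - a j)) powr (1 - r) =
          k * (q - p) powr (1 - r) * (\<Prod>j\<in>S. b j - a j) powr (1 - r)"
        using pq by (simp add: powr_mult)
      have "\<forall>j\<in>insert i S. ?a j \<in> \<rat> \<and> ?b j \<in> \<rat> \<and> ?a j < ?b j" using ab pq by auto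
      from insert.prems(4)[OF this]
      show "(\<integral>\<^sup>+x\<in>box_on S a b. mass (\<lambda>t. H (x(i := t))) p q \<partial>lborel_on S) < top \<and>
        (\<integral>\<^sup>+x\<in>box_on S a b. mass (\<lambda>t. G (x(i := t))) p q \<partial>lborel_on S) \<le>
        ennreal (k * (q - p) powr (1 - r) * (\<Prod>i\<in>S. b i - a i) powr (1 - r)) *
        ennreal_powr (\<integral>\<^sup>+x\<in>box_on S a b. mass (\<lambda>t. H (x(i := t))) p q \<partial>lborel_on S) r"
        unfolding nn_integral_box_insert[OF insert.hyps(1,2) G] nn_integral_box_insert[OF insert.hyps(1,2) H]
          box prod pw by simp
    qed (use k in auto)
  qed
  moreover have "AE x in lborel_on S. x \<in> space (lborel_on S)" by (rule AE_space)
  ultimately have "AE x in lborel_on S. AE t in lborel.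
      G (x(i := t)) \<le> ennreal k * ennreal_powr (H (x(i := t))) r \<and> H (x(i := t)) < top"
  proof eventually_elim
    case (elim x)
    show ?case
      using elim(1) k r
      by (intro AE_le_of_rational_intervals measurable_line[OF G elim(2)] measurable_line[OF H elim(2)]) auto
  qed
  moreover have "Measurable.pred (lborel_on (insert i S)) (\<lambda>y. G y \<le> ennreal k * ennreal_powr (H y) r \<and> H y < top)"
  proof -
    have "(\<lambda>y. ennreal k * ennreal_powr (H y) r) \<in> borel_measurable (lborel_on (insert i S))"
      by (intro borel_measurable_times_ennreal measurable_ennreal_powr H borel_measurable_const)
    then show ?thesis unfolding pred_def using G H
      by (intro sets.sets_Collect_conj borel_measurable_le borel_measurable_less borel_measurable_const)
  qed
  ultimately show ?case by (intro AE_lborel_on_insertI[OF insert.hyps(1,2)])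
qed

section \<open>The maximal function on the line\<close>

definition interval_maximal :: "(real \<Rightarrow> ennreal) \<Rightarrow> real \<Rightarrow> ennreal" where
  "interval_maximal g x = (SUP (p, q)\<in>{(p, q). p < q \<and> x \<in> {p..q}}. mass g p q / ennreal (q - p))"

text \<open>
  The superlevel set need not be known to be measurable; the Vitali covering lemma provides a Borel
  set \<open>U\<close> around it, a union of five-fold enlarged disjoint intervals of average larger than \<open>l\<close>.
\<close>
lemma interval_maximal_weak_type:
  assumes g[measurable]: "g \<in> borel_measurable borel" and fin: "(\<integral>\<^sup>+x. g x \<partial>lborel) < top" and l: "0 < l"
  shows "\<exists>U\<in>sets borel. {x. ennreal l < interval_maximal g x} \<subseteq> U \<and>
    ennreal l * emeasure lborel U \<le> 5 * (\<integral>\<^sup>+x. g x \<partial>lborel)"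
proof -
  define T where "T = (\<integral>\<^sup>+x. g x \<partial>lborel)"
  have massT: "mass g p q \<le> T" for p q
    unfolding mass_def T_def by (intro nn_integral_mono) (auto simp: indicator_def)
  define K where "K = {(p, q). p < q \<and> ennreal (l * (q - p)) < mass g p q}"
  let ?c = "\<lambda>I::real \<times> real. mid (fst I) (snd I)" and ?r = "\<lambda>I::real \<times> real. (snd I - fst I) / 2"
  have ball: "cball (?c I) (s * ?r I) = {?c I - s * ?r I..?c I + s * ?r I}" for I s
    by (simp add: cball_eq_atLeastAtMost)
  have ball1: "cball (?c I) (?r I) = {fst I..snd I}" for I
    by (simp add: cball_eq_atLeastAtMost field_simps)
  have cover: "{x. ennreal l < interval_maximal g x} \<subseteq> (\<Union>I\<in>K. cball (?c I) (?r I))"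
  proof
    fix x assume "x \<in> {x. ennreal l < interval_maximal g x}"
    then obtain p q where pq: "p < q" "x \<in> {p..q}" "ennreal l < mass g p q / ennreal (q - p)"
      by (auto simp: interval_maximal_def less_SUP_iff)
    have "ennreal l * ennreal (q - p) < mass g p q / ennreal (q - p) * ennreal (q - p)"
      using pq by (intro ennreal_mult_strict_right_mono) auto
    also have "\<dots> = mass g p q" using pq by (simp add: ennreal_divide_times)
    finally have "(p, q) \<in> K" using pq l by (simp add: K_def ennreal_mult)
    then show "x \<in> (\<Union>I\<in>K. cball (?c I) (?r I))" using pq(2) unfolding ball1 by force
  qed
  have rad: "0 < ?r I \<and> ?r I \<le> enn2real T / l" if "I \<in> K" for I
  proof -
    obtain p q where I: "I = (p, q)" by (cases I)
    have pq: "p < q" "ennreal (l * (q - p)) < mass g p q" using that by (auto simp: K_def I)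
    have "ennreal (l * (q - p)) \<le> ennreal (enn2real T)"
      using pq(2) massT[of p q] fin by (simp add: T_def less_top)
    then have "l * (q - p) \<le> enn2real T" by (simp add: ennreal_le_iff)
    then have "q - p \<le> enn2real T / l" using l by (simp add: field_simps)
    moreover have "0 < (q - p) / 2" "(q - p) / 2 < q - p" using pq(1) by simp_all
    ultimately have "0 < (q - p) / 2 \<and> (q - p) / 2 \<le> enn2real T / l" by linarith
    then show ?thesis by (simp only: I fst_conv snd_conv)
  qed
  obtain C where C: "countable C" "C \<subseteq> K"
    "pairwise (\<lambda>i j. disjnt (cball (?c i) (?r i)) (cball (?c j) (?r j))) C"
    "{x. ennreal l < interval_maximal g x} \<subseteq> (\<Union>i\<in>C. cball (?c i) (5 * ?r i))"
    using Vitali_covering_lemma_cballs[OF cover rad] by blast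
  let ?U = "\<Union>i\<in>C. cball (?c i) (5 * ?r i)"
  have U: "?U \<in> sets borel" using C(1) by (intro sets.countable_UN') auto
  have "emeasure lborel ?U = (\<integral>\<^sup>+x. indicator ?U x \<partial>lborel)" using U by simp
  also have "\<dots> \<le> (\<integral>\<^sup>+x. \<integral>\<^sup>+i. indicator (cball (?c i) (5 * ?r i)) x \<partial>count_space C \<partial>lborel)"
  proof (rule nn_integral_mono)
    fix x :: real
    show "indicator ?U x \<le> (\<integral>\<^sup>+i. indicator (cball (?c i) (5 * ?r i)) x \<partial>count_space C)"
    proof (cases "x \<in> ?U")
      case True
      then obtain i where i: "i \<in> C" "x \<in> cball (?c i) (5 * ?r i)" by blast
      have "indicator ?U x = (indicator (cball (?c i) (5 * ?r i)) x :: ennreal)"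
        using True i(2) by simp
      also have "\<dots> \<le> (\<integral>\<^sup>+i. indicator (cball (?c i) (5 * ?r i)) x \<partial>count_space C)"
        using nn_integral_ge_point[OF i(1), of "\<lambda>i. indicator (cball (?c i) (5 * ?r i)) x"] .
      finally show ?thesis .
    qed simp
  qed
  also have "\<dots> = (\<integral>\<^sup>+i. \<integral>\<^sup>+x. indicator (cball (?c i) (5 * ?r i)) x \<partial>lborel \<partial>count_space C)"
    by (intro nn_integral_count_space_nn_integral[OF C(1)] borel_measurable_indicator) simp
  finally have "ennreal l * emeasure lborel ?U \<le>
      ennreal l * (\<integral>\<^sup>+i. \<integral>\<^sup>+x. indicator (cball (?c i) (5 * ?r i)) x \<partial>lborel \<partial>count_space C)"
    by (rule mult_left_mono) simp
  also have "\<dots> = (\<integral>\<^sup>+i. ennreal l * (\<integral>\<^sup>+x. indicator (cball (?c i) (5 * ?r i)) x \<partial>lborel) \<partial>count_space C)"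
    by (rule nn_integral_cmult[symmetric]) simp
  also have "\<dots> \<le> (\<integral>\<^sup>+i. 5 * emeasure (density lborel g) {fst i..snd i} \<partial>count_space C)"
  proof (rule nn_integral_mono)
    fix i assume "i \<in> space (count_space C)"
    then have i: "i \<in> K" using C(2) by auto
    obtain p q where I: "i = (p, q)" by (cases i)
    have pq: "p < q" "ennreal (l * (q - p)) < mass g p q" using i by (auto simp: K_def I)
    have "(\<integral>\<^sup>+x. indicator (cball (?c i) (5 * ?r i)) x \<partial>lborel) = emeasure lborel (cball (?c i) (5 * ?r i))"
      by simp
    also have "\<dots> = ennreal (5 * (q - p))" unfolding ball using pq by (simp add: I field_simps)
    also have "\<dots> = 5 * ennreal (q - p)" using pq by (subst ennreal_mult) auto
    finally have "ennreal l * (\<integral>\<^sup>+x. indicator (cball (?c i) (5 * ?r i)) x \<partial>lborel) = 5 * ennreal (l * (q - p))"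
      using l pq by (simp add: ennreal_mult mult_ac)
    also have "\<dots> \<le> 5 * mass g p q" using pq by (intro mult_left_mono) auto
    also have "mass g p q = emeasure (density lborel g) {fst i..snd i}"
      by (simp add: emeasure_density mass_def I)
    finally show "ennreal l * (\<integral>\<^sup>+x. indicator (cball (?c i) (5 * ?r i)) x \<partial>lborel) \<le>
        5 * emeasure (density lborel g) {fst i..snd i}" .
  qed
  also have "\<dots> = 5 * (\<integral>\<^sup>+i. emeasure (density lborel g) {fst i..snd i} \<partial>count_space C)"
    by (rule nn_integral_cmult) simp
  also have "(\<integral>\<^sup>+i. emeasure (density lborel g) {fst i..snd i} \<partial>count_space C) =
      emeasure (density lborel g) (\<Union>i\<in>C. {fst i..snd i})"
    using C(1,3) unfolding ball1
    by (intro emeasure_UN_countable[symmetric]) (auto simp: disjoint_family_on_def pairwise_def disjnt_def)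
  also have "5 * \<dots> \<le> 5 * emeasure (density lborel g) UNIV"
    by (intro mult_left_mono emeasure_mono) auto
  also have "emeasure (density lborel g) UNIV = T" by (simp add: emeasure_density T_def)
  finally have "ennreal l * emeasure lborel ?U \<le> 5 * T" .
  then show ?thesis using U C(4) unfolding T_def by blast
qed

text \<open>
  Values of \<open>g\<close> below \<open>l\<close> contribute at most \<open>l\<close> to an average, so an average above \<open>2 * l\<close> needs
  the part of \<open>g\<close> above \<open>l\<close> to have average larger than \<open>l\<close>.
\<close>
lemma interval_maximal_truncated_weak_type:
  assumes g[measurable]: "g \<in> borel_measurable borel" and fin: "(\<integral>\<^sup>+x. g x \<partial>lborel) < top" and l: "0 < l"
  shows "\<exists>U\<in>sets borel. {x. ennreal (2 * l) < interval_maximal g x} \<subseteq> U \<and>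
    ennreal (2 * l) * emeasure lborel U \<le> 10 * (\<integral>\<^sup>+x\<in>{x. ennreal l < g x}. g x \<partial>lborel)"
proof -
  define h where "h = (\<lambda>x. g x * indicator {x. ennreal l < g x} x)"
  have h[measurable]: "h \<in> borel_measurable borel" unfolding h_def by measurable
  have "(\<integral>\<^sup>+x. h x \<partial>lborel) \<le> (\<integral>\<^sup>+x. g x \<partial>lborel)"
    unfolding h_def by (intro nn_integral_mono) (auto simp: indicator_def)
  then have hfin: "(\<integral>\<^sup>+x. h x \<partial>lborel) < top" using fin by (rule le_less_trans)
  obtain U where U: "U \<in> sets borel" "{x. ennreal l < interval_maximal h x} \<subseteq> U"
    "ennreal l * emeasure lborel U \<le> 5 * (\<integral>\<^sup>+x. h x \<partial>lborel)"
    using interval_maximal_weak_type[OF h hfin l] by blast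
  have "interval_maximal g x \<le> ennreal l + interval_maximal h x" for x
    unfolding interval_maximal_def[of g]
  proof (rule SUP_least, clarsimp)
    fix p q assume pq: "p < q" "p \<le> x" "x \<le> q"
    have "mass g p q \<le> (\<integral>\<^sup>+x. ennreal l * indicator {p..q} x + h x * indicator {p..q} x \<partial>lborel)"
      unfolding mass_def h_def by (intro nn_integral_mono) (auto simp: indicator_def)
    also have "\<dots> = ennreal l * ennreal (q - p) + mass h p q"
      unfolding mass_def using pq by (subst nn_integral_add) (auto simp: nn_integral_cmult)
    finally have "mass g p q / ennreal (q - p) \<le> (ennreal l * ennreal (q - p) + mass h p q) / ennreal (q - p)"
      by (rule divide_right_mono_ennreal)
    also have "\<dots> = ennreal l + mass h p q / ennreal (q - p)"
      using pq by (simp add: add_divide_distrib_ennreal mult_divide_eq_ennreal)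
    also have "\<dots> \<le> ennreal l + interval_maximal h x"
      unfolding interval_maximal_def using pq by (intro add_left_mono SUP_upper2[of "(p, q)"]) auto
    finally show "mass g p q / ennreal (q - p) \<le> \<dots>" .
  qed
  then have "{x. ennreal (2 * l) < interval_maximal g x} \<subseteq> {x. ennreal l < interval_maximal h x}"
  proof (intro subsetI CollectI)
    fix x assume le: "\<And>x. interval_maximal g x \<le> ennreal l + interval_maximal h x"
      and x: "x \<in> {x. ennreal (2 * l) < interval_maximal g x}"
    show "ennreal l < interval_maximal h x"
    proof (rule ccontr)
      assume "\<not> ennreal l < interval_maximal h x"
      then have "interval_maximal g x \<le> ennreal l + ennreal l"
        using le[of x] by (meson add_left_mono not_less order_trans)
      also have "\<dots> = ennreal (2 * l)" using l by (simp flip: ennreal_plus)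
      finally show False using x by auto
    qed
  qed
  moreover have "ennreal (2 * l) * emeasure lborel U \<le> 10 * (\<integral>\<^sup>+x. h x \<partial>lborel)"
  proof -
    have "ennreal (2 * l) * emeasure lborel U = 2 * (ennreal l * emeasure lborel U)"
      using l by (simp add: ennreal_mult mult.assoc)
    also have "\<dots> \<le> 2 * (5 * (\<integral>\<^sup>+x. h x \<partial>lborel))" by (intro mult_left_mono U(3)) simp
    finally show ?thesis by (simp flip: mult.assoc)
  qed
  ultimately show ?thesis using U(1,2) unfolding h_def by blast
qed

text \<open>
  The number of \<open>k\<close> with $2^k < y$ is at most $1 + 2 \ln y$ if $y > 1$, and
  $\ln z \le z - 1$ for $z = y^{r-1} / B^r$ bounds $(r-1) \ln y$ by $r \ln B + z$. The
  normalization by $B^r$ makes the integral of the last term bounded independently of \<open>B\<close> when a reverse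
  Hoelder inequality with constant \<open>B\<close> holds.
\<close>
lemma dyadic_level_count_le:
  fixes y r B :: real
  assumes "0 \<le> y" "1 < r" "1 \<le> B"
  shows "(\<Sum>k<n. if 2 ^ k < y then 1 else 0) \<le> 1 + 2 / (r - 1) * (r * ln B + y powr (r - 1) / B powr r)"
proof -
  have pos: "0 \<le> 2 / (r - 1) * (r * ln B + y powr (r - 1) / B powr r)"
    using assms by (intro mult_nonneg_nonneg add_nonneg_nonneg divide_nonneg_nonneg) auto
  show ?thesis
  proof (cases "1 < y")
    case True
    have count: "(\<Sum>k<n. if 2 ^ k < y then 1 else 0 :: real) \<le> 1 + 2 * ln y"
    proof (induction n)
      case 0
      then show ?case using True by simp
    next
      case (Suc n)
      show ?case
      proof (cases "2 ^ n < y")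
        case False
        then show ?thesis using Suc by simp
      next
        case True2: True
        have "ln (2 ^ n) < ln y" using True2 True by (subst ln_less_cancel_iff) auto
        then have "real n * ln 2 < ln y" by (simp add: ln_realpow)
        moreover have "real n * (1 / 2) \<le> real n * ln 2"
          using ln2_ge_two_thirds by (intro mult_left_mono) auto
        ultimately have "real n \<le> 2 * ln y" by simp
        moreover have "(\<Sum>k<Suc n. if 2 ^ k < y then 1 else 0 :: real) \<le> (\<Sum>k<Suc n. 1)"
          by (intro sum_mono) auto
        ultimately show ?thesis by simp
      qed
    qed
    define z where "z = y powr (r - 1) / B powr r"
    have z: "0 < z" using True assms by (simp add: z_def)
    have "ln z = (r - 1) * ln y - r * ln B"
      unfolding z_def using True assms by (simp add: ln_div ln_powr)
    moreover have "ln z \<le> z - 1" using z by (rule ln_le_minus_one)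
    ultimately have "(r - 1) * ln y \<le> r * ln B + z" by linarith
    then have "ln y \<le> (r * ln B + z) / (r - 1)" using assms(2) by (simp add: field_simps)
    then have "2 * ln y \<le> 2 * ((r * ln B + z) / (r - 1))"
      by (rule mult_left_mono) simp
    also have "\<dots> = 2 / (r - 1) * (r * ln B + y powr (r - 1) / B powr r)" by (simp add: z_def)
    finally show ?thesis using count by linarith
  next
    case False
    have "(\<Sum>k<n. if 2 ^ k < y then 1 else 0 :: real) = 0"
    proof (intro sum.neutral ballI)
      fix k
      have "(1::real) \<le> 2 ^ k" by simp
      then have "\<not> 2 ^ k < y" using False by linarith
      then show "(if 2 ^ k < y then 1 else 0 :: real) = 0" by simp
    qed
    then show ?thesis using pos by linarith
  qed
qed

text \<open>
  The first level and the layers below \<open>X\<close> add up to at least \<open>X\<close>, since each level differs from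
  the next by its own size; if \<open>X\<close> is infinite, then so is the series.
\<close>
lemma ennreal_le_dyadic_levels:
  fixes X :: ennreal
  assumes u: "0 < u"
  shows "X \<le> ennreal (2 * u) + (\<Sum>k. ennreal (2 * (2 ^ k * u)) * (if ennreal (2 * (2 ^ k * u)) < X then 1 else 0))"
proof -
  let ?l = "\<lambda>k. ennreal (2 * (2 ^ k * u))"
  let ?t = "\<lambda>k. ?l k * (if ?l k < X then 1 else 0)"
  have min: "min X (?l n) \<le> ennreal (2 * u) + (\<Sum>k<n. ?t k)" for n
  proof (induction n)
    case (Suc n)
    show ?case
    proof (cases "?l n < X")
      case True
      have "min X (?l (Suc n)) \<le> ?l (Suc n)" by simp
      also have "\<dots> = ?l n + ?l n" using u by (simp flip: ennreal_plus)
      also have "\<dots> \<le> (ennreal (2 * u) + (\<Sum>k<n. ?t k)) + ?l n"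
        using Suc unfolding min_absorb2[OF less_imp_le[OF True]] by (rule add_right_mono)
      finally show ?thesis using True by (simp add: add.assoc)
    next
      case False
      then have "X \<le> ?l n" by (simp only: not_less)
      then have "min X (?l (Suc n)) \<le> min X (?l n)" by (simp only: min_absorb1 min.cobounded1)
      also have "\<dots> \<le> ennreal (2 * u) + (\<Sum>k<Suc n. ?t k)" using Suc False by simp
      finally show ?thesis .
    qed
  qed simp
  have part: "min X (?l n) \<le> ennreal (2 * u) + (\<Sum>k. ?t k)" for n
    using min[of n] sum_le_suminf[of ?t "{..<n}"] by (meson add_left_mono finite_lessThan order_trans summableI zero_le)
  show ?thesis
  proof (rule ccontr)
    let ?S = "ennreal (2 * u) + (\<Sum>k. ?t k)"
    assume "\<not> X \<le> ?S"
    then have lt: "?S < X" by simp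
    then have "?S < top" using top_greatest by (rule less_le_trans)
    then obtain s where s: "?S = ennreal s" "0 \<le> s" by (cases ?S) auto
    obtain n where "s / (2 * u) < 2 ^ n" using real_arch_pow[of 2 "s / (2 * u)"] by auto
    then have "s < 2 * (2 ^ n * u)" using u by (simp add: field_simps)
    then have "?S < ?l n" unfolding s(1) using s(2) by (simp add: ennreal_less_iff)
    with lt have "?S < min X (?l n)" by (rule min_less_iff_conj[THEN iffD2, OF conjI])
    with part[of n] show False by (meson leD)
  qed
qed

text \<open>
  The logarithmic bound for the maximal function. The layers of the maximal function at the levels
  $2 \cdot 2^k u$ are estimated by the truncated weak type inequality; summing over \<open>k\<close> first
  produces the number of levels below $g(x)$, to which \<open>dyadic_level_count_le\<close> applies.
\<close>
lemma interval_maximal_integral_le: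
  assumes g[measurable]: "g \<in> borel_measurable borel" and cd: "c < d"
    and T: "(\<integral>\<^sup>+x. g x \<partial>lborel) = ennreal t" "0 < t"
    and r: "1 < r" "1 \<le> B"
    and rh: "(\<integral>\<^sup>+x. ennreal_powr (g x) r \<partial>lborel) \<le> ennreal (B powr r * (d - c) powr (1 - r) * t powr r)"
  shows "(\<integral>\<^sup>+x\<in>{c..d}. interval_maximal g x \<partial>lborel) \<le> ennreal (32 * (r / (r - 1)) * (1 + ln B)) * ennreal t"
proof -
  define u where "u = t / (d - c)"
  have u: "0 < u" using T cd by (simp add: u_def)
  let ?l = "\<lambda>k. 2 ^ k * u"
  have "\<forall>k. \<exists>U. U \<in> sets borel \<and> {x. ennreal (2 * ?l k) < interval_maximal g x} \<subseteq> U \<and>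
    ennreal (2 * ?l k) * emeasure lborel U \<le> 10 * (\<integral>\<^sup>+x\<in>{x. ennreal (?l k) < g x}. g x \<partial>lborel)"
  proof
    fix k
    have "0 < ?l k" "(\<integral>\<^sup>+x. g x \<partial>lborel) < top" using u T by auto
    from interval_maximal_truncated_weak_type[OF g this(2,1)]
    show "\<exists>U. U \<in> sets borel \<and> {x. ennreal (2 * ?l k) < interval_maximal g x} \<subseteq> U \<and>
      ennreal (2 * ?l k) * emeasure lborel U \<le> 10 * (\<integral>\<^sup>+x\<in>{x. ennreal (?l k) < g x}. g x \<partial>lborel)"
      by blast
  qed
  from choice[OF this] obtain U where U: "\<And>k. U k \<in> sets borel"
    "\<And>k. {x. ennreal (2 * ?l k) < interval_maximal g x} \<subseteq> U k"
    "\<And>k. ennreal (2 * ?l k) * emeasure lborel (U k) \<le> 10 * (\<integral>\<^sup>+x\<in>{x. ennreal (?l k) < g x}. g x \<partial>lborel)"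
    by blast
  note [measurable] = U(1)
  \<comment> \<open>By \<open>dyadic_level_count_le\<close> for $y = g(x)/u$, the sum over all levels of \<open>g x\<close> is at most
     $a\,g(x) + b\,g(x)^r$.\<close>
  define a where "a = 1 + 2 / (r - 1) * (r * ln B)"
  define b where "b = 2 / (r - 1) * (u powr (1 - r) / B powr r)"
  have ab: "0 \<le> a" "0 \<le> b" using r u by (auto simp: a_def b_def)
  have "(\<integral>\<^sup>+x\<in>{c..d}. interval_maximal g x \<partial>lborel) \<le>
      (\<integral>\<^sup>+x. ennreal (2 * u) * indicator {c..d} x + (\<Sum>k. ennreal (2 * ?l k) * indicator (U k) x) \<partial>lborel)"
  proof (rule nn_integral_mono)
    fix x
    have "interval_maximal g x \<le> ennreal (2 * u) +
        (\<Sum>k. ennreal (2 * ?l k) * (if ennreal (2 * ?l k) < interval_maximal g x then 1 else 0))"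
      by (rule ennreal_le_dyadic_levels[OF u])
    also have "\<dots> \<le> ennreal (2 * u) + (\<Sum>k. ennreal (2 * ?l k) * indicator (U k) x)"
    proof (intro add_left_mono suminf_le mult_left_mono summableI)
      fix k
      show "(if ennreal (2 * ?l k) < interval_maximal g x then 1 else 0) \<le> (indicator (U k) x :: ennreal)"
        using U(2)[of k] by (cases "ennreal (2 * ?l k) < interval_maximal g x") auto
    qed simp
    finally show "interval_maximal g x * indicator {c..d} x \<le>
        ennreal (2 * u) * indicator {c..d} x + (\<Sum>k. ennreal (2 * ?l k) * indicator (U k) x)"
      by (auto simp: indicator_def)
  qed
  also have "\<dots> = (\<integral>\<^sup>+x. ennreal (2 * u) * indicator {c..d} x \<partial>lborel) +
      (\<integral>\<^sup>+x. (\<Sum>k. ennreal (2 * ?l k) * indicator (U k) x) \<partial>lborel)"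
    by (rule nn_integral_add) measurable
  also have "(\<integral>\<^sup>+x. ennreal (2 * u) * indicator {c..d} x \<partial>lborel) = ennreal (2 * t)"
    using cd u by (simp add: nn_integral_cmult ennreal_mult[symmetric] u_def)
  finally have split: "(\<integral>\<^sup>+x\<in>{c..d}. interval_maximal g x \<partial>lborel) \<le>
      ennreal (2 * t) + (\<integral>\<^sup>+x. (\<Sum>k. ennreal (2 * ?l k) * indicator (U k) x) \<partial>lborel)" .
  have "(\<integral>\<^sup>+x. (\<Sum>k. ennreal (2 * ?l k) * indicator (U k) x) \<partial>lborel) =
      (\<Sum>k. \<integral>\<^sup>+x. ennreal (2 * ?l k) * indicator (U k) x \<partial>lborel)"
    by (rule nn_integral_suminf) measurable
  also have "\<dots> = (\<Sum>k. ennreal (2 * ?l k) * emeasure lborel (U k))"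
    by (simp add: nn_integral_cmult)
  also have "\<dots> \<le> (\<Sum>k. 10 * (\<integral>\<^sup>+x\<in>{x. ennreal (?l k) < g x}. g x \<partial>lborel))"
    by (intro suminf_le U(3)) auto
  also have "\<dots> = 10 * (\<integral>\<^sup>+x. (\<Sum>k. g x * indicator {x. ennreal (?l k) < g x} x) \<partial>lborel)"
    by (subst nn_integral_suminf) auto
  finally have levels: "(\<integral>\<^sup>+x. (\<Sum>k. ennreal (2 * ?l k) * indicator (U k) x) \<partial>lborel) \<le>
      10 * (\<integral>\<^sup>+x. (\<Sum>k. g x * indicator {x. ennreal (?l k) < g x} x) \<partial>lborel)" .
  have "(\<integral>\<^sup>+x. (\<Sum>k. g x * indicator {x. ennreal (?l k) < g x} x) \<partial>lborel)
      \<le> (\<integral>\<^sup>+x. ennreal a * g x + ennreal b * ennreal_powr (g x) r \<partial>lborel)"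
  proof (rule nn_integral_mono_AE)
    have "AE x in lborel. g x \<noteq> \<infinity>"
      using T by (intro nn_integral_noteq_infinite) auto
    then show "AE x in lborel. (\<Sum>k. g x * indicator {x. ennreal (?l k) < g x} x)
        \<le> ennreal a * g x + ennreal b * ennreal_powr (g x) r"
    proof eventually_elim
      fix x assume "g x \<noteq> \<infinity>"
      then obtain y where y: "g x = ennreal y" "0 \<le> y" by (cases "g x") auto
      have part: "(\<Sum>k<n. g x * indicator {x. ennreal (?l k) < g x} x) \<le> ennreal (a * y + b * y powr r)" for n
      proof -
        have sums: "(\<Sum>k<n. g x * indicator {x. ennreal (?l k) < g x} x) =
            ennreal (\<Sum>k<n. y * (if 2 ^ k < y / u then 1 else 0))"
        proof -
          have "(\<Sum>k<n. g x * indicator {x. ennreal (?l k) < g x} x) =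
            (\<Sum>k<n. ennreal (y * (if 2 ^ k < y / u then 1 else 0)))"
            using u y by (intro sum.cong) (auto simp: indicator_def ennreal_less_iff field_simps)
          also have "\<dots> = ennreal (\<Sum>k<n. y * (if 2 ^ k < y / u then 1 else 0))"
            using y by (intro sum_ennreal) auto
          finally show ?thesis .
        qed
        have "(\<Sum>k<n. y * (if 2 ^ k < y / u then 1 else 0)) = y * (\<Sum>k<n. if 2 ^ k < y / u then 1 else 0)"
          by (simp only: sum_distrib_left)
        also have "\<dots> \<le> y * (1 + 2 / (r - 1) * (r * ln B + (y / u) powr (r - 1) / B powr r))"
          using y u r by (intro mult_left_mono dyadic_level_count_le) auto
        also have "\<dots> = a * y + 2 / (r - 1) * (y * (y / u) powr (r - 1) / B powr r)"
          by (simp add: a_def algebra_simps)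
        also have "y * (y / u) powr (r - 1) = u powr (1 - r) * y powr r"
        proof (cases "y = 0")
          case False
          have "y * y powr (r - 1) = y powr r" using False y by (simp add: powr_mult_base)
          moreover have "u powr (1 - r) = 1 / u powr (r - 1)"
            by (metis minus_diff_eq powr_minus_divide)
          ultimately show ?thesis using y u by (simp add: powr_divide)
        qed simp
        also have "2 / (r - 1) * (u powr (1 - r) * y powr r / B powr r) = b * y powr r"
          by (simp add: b_def)
        finally have "ennreal (\<Sum>k<n. y * (if 2 ^ k < y / u then 1 else 0)) \<le> ennreal (a * y + b * y powr r)"
          by (rule ennreal_leI)
        with sums show ?thesis by simp
      qed
      have "(\<Sum>k. g x * indicator {x. ennreal (?l k) < g x} x) \<le> ennreal (a * y + b * y powr r)"
        by (intro suminf_le_const summableI part)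
      then show "(\<Sum>k. g x * indicator {x. ennreal (?l k) < g x} x)
        \<le> ennreal a * g x + ennreal b * ennreal_powr (g x) r"
        using y ab by (simp add: ennreal_mult)
    qed
  qed
  also have "\<dots> = ennreal a * ennreal t + ennreal b * (\<integral>\<^sup>+x. ennreal_powr (g x) r \<partial>lborel)"
    using T by (subst nn_integral_add) (auto simp: nn_integral_cmult)
  also have "\<dots> \<le> ennreal a * ennreal t + ennreal b * ennreal (B powr r * (d - c) powr (1 - r) * t powr r)"
    by (intro add_left_mono mult_left_mono rh) simp
  also have "\<dots> = ennreal (a * t + b * (B powr r * (d - c) powr (1 - r) * t powr r))"
    using ab T by (simp add: ennreal_mult)
  also have "b * (B powr r * (d - c) powr (1 - r) * t powr r) = 2 / (r - 1) * t"
  proof -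
    have "u powr (1 - r) = t powr (1 - r) / (d - c) powr (1 - r)"
      using T cd by (simp add: u_def powr_divide)
    then have "b * (B powr r * (d - c) powr (1 - r) * t powr r) = 2 / (r - 1) * (t powr (1 - r) * t powr r)"
      using r cd by (simp add: b_def)
    also have "t powr (1 - r) * t powr r = t" using T by (simp flip: powr_add)
    finally show ?thesis .
  qed
  finally have "10 * (\<integral>\<^sup>+x. (\<Sum>k. g x * indicator {x. ennreal (?l k) < g x} x) \<partial>lborel) \<le>
      10 * ennreal (a * t + 2 / (r - 1) * t)"
    by (rule mult_left_mono) simp
  then have "(\<integral>\<^sup>+x\<in>{c..d}. interval_maximal g x \<partial>lborel) \<le>
      ennreal (2 * t) + 10 * ennreal (a * t + 2 / (r - 1) * t)"
    by (intro order_trans[OF split] add_left_mono order_trans[OF levels])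
  also have "\<dots> = ennreal (2 * t + 10 * (a * t + 2 / (r - 1) * t))"
  proof -
    have X: "0 \<le> a * t + 2 / (r - 1) * t" using ab T r by simp
    then have "10 * ennreal (a * t + 2 / (r - 1) * t) = ennreal (10 * (a * t + 2 / (r - 1) * t))"
      by (subst ennreal_mult) auto
    then show ?thesis using X T(2) by (subst ennreal_plus) auto
  qed
  also have "\<dots> \<le> ennreal (32 * (r / (r - 1)) * (1 + ln B) * t)"
  proof (rule ennreal_leI)
    define q where "q = r / (r - 1)"
    have q: "1 \<le> q" "1 / (r - 1) \<le> q" using r by (auto simp: q_def field_simps)
    have a: "a = 1 + 2 * q * ln B" by (simp add: a_def q_def)
    have "0 \<le> q * ln B" using q r by simp
    then have "2 + 10 * (a + 2 * (1 / (r - 1))) \<le> 32 * q * (1 + ln B)"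
      using q unfolding a by (simp add: algebra_simps)
    then have "(2 + 10 * (a + 2 * (1 / (r - 1)))) * t \<le> 32 * q * (1 + ln B) * t"
      using T by (intro mult_right_mono) auto
    then show "2 * t + 10 * (a * t + 2 / (r - 1) * t) \<le> 32 * (r / (r - 1)) * (1 + ln B) * t"
      by (simp add: q_def algebra_simps)
  qed
  also have "\<dots> = ennreal (32 * (r / (r - 1)) * (1 + ln B)) * ennreal t"
    using T r by (intro ennreal_mult) auto
  finally show ?thesis .
qed

lemma maximal1_eq_interval_maximal:
  assumes "\<And>t. 0 \<le> f t" "AE t in lborel. ennreal (f t) = g t"
  shows "maximal1 f x = interval_maximal g x"
  unfolding maximal1_def interval_maximal_def
proof (rule SUP_cong[OF refl])
  fix z assume "z \<in> {(p, q). p < q \<and> x \<in> {p..q}}"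
  then obtain a b where z: "z = (a, b)" and ab: "a < b" by auto
  have "(\<integral>\<^sup>+t\<in>{a..b}. ennreal \<bar>f t\<bar> \<partial>lebesgue) = mass g a b"
    unfolding nn_integral_completion mass_def using assms
    by (intro nn_integral_cong_AE) (auto elim!: eventually_mono)
  then show "(case z of (a, b) \<Rightarrow> (\<integral>\<^sup>+t\<in>{a..b}. ennreal \<bar>f t\<bar> \<partial>lebesgue) / emeasure lebesgue {a..b}) =
      (case z of (p, q) \<Rightarrow> mass g p q / ennreal (q - p))"
    using ab by (simp add: z)
qed

lemma interval_average_le_interval_maximal:
  "p < q \<Longrightarrow> x \<in> {p..q} \<Longrightarrow> mass g p q / ennreal (q - p) \<le> interval_maximal g x"
  unfolding interval_maximal_def by (intro SUP_upper2[of "(p, q)"]) auto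

lemma fujii_wilson_quotient:
  assumes v: "\<And>t. 0 \<le> v t" "AE t in lborel. ennreal (v t) = g t"
  shows "fujii_wilson v = (SUP (a, b)\<in>{(a, b). a < b}.
     (\<integral>\<^sup>+x\<in>{a..b}. interval_maximal (\<lambda>t. g t * indicator {a..b} t) x \<partial>lborel) / mass g a b)"
  unfolding fujii_wilson_def
proof (rule SUP_cong[OF refl])
  fix z :: "real \<times> real"
  obtain a b where z: "z = (a, b)" by (cases z)
  have "maximal1 (\<lambda>t. v t * indicator {a..b} t) = interval_maximal (\<lambda>t. g t * indicator {a..b} t)"
    using v by (intro ext maximal1_eq_interval_maximal) (auto elim!: eventually_mono simp: indicator_def)
  moreover have "(\<integral>\<^sup>+x\<in>{a..b}. ennreal (v x) \<partial>lebesgue) = mass g a b"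
    unfolding nn_integral_completion mass_def using v
    by (intro nn_integral_cong_AE) (auto elim!: eventually_mono)
  ultimately show "(case z of (a, b) \<Rightarrow>
      (\<integral>\<^sup>+x\<in>{a..b}. maximal1 (\<lambda>t. v t * indicator {a..b} t) x \<partial>lebesgue) /
      (\<integral>\<^sup>+x\<in>{a..b}. ennreal (v x) \<partial>lebesgue)) = (case z of (a, b) \<Rightarrow>
    (\<integral>\<^sup>+x\<in>{a..b}. interval_maximal (\<lambda>t. g t * indicator {a..b} t) x \<partial>lborel) / mass g a b)"
    by (simp add: z nn_integral_completion)
qed

lemma mass_restrict:
  "a \<le> c \<Longrightarrow> d \<le> b \<Longrightarrow> mass (\<lambda>t. g t * indicator {a..b} t) c d = mass g c d"
  unfolding mass_def by (intro nn_integral_cong) (auto simp: indicator_def)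

section \<open>The Fujii-Wilson constant of a line\<close>

text \<open>
  The positivity of \<open>A\<close> matters when the mass is infinite: the quotient in the Fujii-Wilson constant is
  then 0 and gives no information, but the right-hand side is infinite as well.
\<close>
theorem fujii_wilson_imp_dyadic_A_infty:
  assumes v: "\<And>t. 0 \<le> v t" "AE t in lborel. ennreal (v t) = g t"
    and FW: "fujii_wilson v \<le> ennreal A" "0 < A"
  shows "dyadic_A_infty A (mass g) a b"
  unfolding dyadic_A_infty_def
proof (intro allI impI)
  fix N c d assume "a \<le> c \<and> c < d \<and> d \<le> b"
  then have cd: "c < d" by simp
  let ?M = "interval_maximal (\<lambda>t. g t * indicator {c..d} t)"
  let ?n = "\<integral>\<^sup>+x\<in>{c..d}. ?M x \<partial>lborel"
  have "\<exists>f\<in>borel_measurable lborel. (\<forall>x. f x \<le> ?M x * indicator {c<..d} x) \<and>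
    (\<integral>\<^sup>+x. f x \<partial>lborel) = dyadic_max N (mass g) 0 c d"
  proof (rule dyadic_max_step_function[OF cd])
    fix p q x assume pq: "c \<le> p" "p < q" "q \<le> d" "x \<in> {p..q}"
    show "mass g p q / ennreal (q - p) \<le> ?M x"
      using interval_average_le_interval_maximal[OF pq(2,4), of "\<lambda>t. g t * indicator {c..d} t"]
      unfolding mass_restrict[OF pq(1,3)] .
  qed simp
  then obtain f where f: "\<And>x. f x \<le> ?M x * indicator {c<..d} x"
    "(\<integral>\<^sup>+x. f x \<partial>lborel) = dyadic_max N (mass g) 0 c d" by blast
  have "dyadic_max N (mass g) 0 c d \<le> ?n"
    unfolding f(2)[symmetric]
  proof (rule nn_integral_mono)
    fix x
    show "f x \<le> ?M x * indicator {c..d} x"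
      by (rule order_trans[OF f(1)], rule mult_left_mono) (auto simp: indicator_def)
  qed
  also have "?n \<le> ennreal A * mass g c d"
  proof -
    have q: "?n / mass g c d \<le> ennreal A"
      using FW(1) cd unfolding fujii_wilson_quotient[OF v] SUP_le_iff by auto
    consider "mass g c d = 0" | "mass g c d = top" | "0 < mass g c d" "mass g c d < top"
      by (metis less_top zero_less_iff_neq_zero)
    then show ?thesis
    proof cases
      case 1
      then show ?thesis using q by (auto simp: top_unique split: if_splits)
    next
      case 2
      then show ?thesis using FW(2) by (simp add: ennreal_mult_top)
    next
      case 3
      have "?n = ?n / mass g c d * mass g c d"
        using 3 by (simp add: ennreal_divide_times)
      also have "\<dots> \<le> ennreal A * mass g c d" using q by (rule mult_right_mono) simp
      finally show ?thesis .
    qed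
  qed
  finally show "dyadic_max N (mass g) 0 c d \<le> ennreal A * mass g c d" .
qed

text \<open>
  If \<open>g\<close> vanishes almost everywhere on the interval, numerator and denominator of the quotient are both 0.
\<close>
theorem fujii_wilson_le:
  assumes v: "\<And>t. 0 \<le> v t" "AE t in lborel. ennreal (v t) = g t"
    and g[measurable]: "g \<in> borel_measurable borel"
    and r: "1 < r" "1 \<le> B"
    and fin: "\<And>c d. c < d \<Longrightarrow> mass g c d < top"
    and rh: "\<And>c d. c < d \<Longrightarrow> mass (\<lambda>t. ennreal_powr (g t) r) c d \<le>
      ennreal (B powr r * (d - c) powr (1 - r)) * ennreal_powr (mass g c d) r"
  shows "fujii_wilson v \<le> ennreal (32 * (r / (r - 1)) * (1 + ln B))"
  unfolding fujii_wilson_quotient[OF v]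
proof (rule SUP_least)
  fix z :: "real \<times> real" assume "z \<in> {(a, b). a < b}"
  then obtain c d where z: "z = (c, d)" and cd: "c < d" by auto
  let ?h = "\<lambda>t. g t * indicator {c..d} t"
  let ?n = "\<integral>\<^sup>+x\<in>{c..d}. interval_maximal ?h x \<partial>lborel"
  have T: "(\<integral>\<^sup>+x. ?h x \<partial>lborel) = mass g c d" by (simp add: mass_def)
  have "?n / mass g c d \<le> ennreal (32 * (r / (r - 1)) * (1 + ln B))"
  proof (cases "mass g c d = 0")
    case True
    have "mass ?h p q = 0" for p q
    proof -
      have "mass ?h p q \<le> (\<integral>\<^sup>+x. ?h x \<partial>lborel)"
        unfolding mass_def by (intro nn_integral_mono) (auto simp: indicator_def)
      then show ?thesis unfolding T True by simp
    qed
    then have "interval_maximal ?h x \<le> 0" for x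
      unfolding interval_maximal_def by (intro SUP_least) auto
    then show ?thesis by simp
  next
    case False
    define t where "t = enn2real (mass g c d)"
    have t: "mass g c d = ennreal t" "0 < t"
      using False fin[OF cd] by (auto simp: t_def less_top enn2real_positive_iff zero_less_iff_neq_zero)
    have "?n \<le> ennreal (32 * (r / (r - 1)) * (1 + ln B)) * ennreal t"
    proof (rule interval_maximal_integral_le[OF _ cd _ t(2) r])
      have "(\<integral>\<^sup>+x. ennreal_powr (?h x) r \<partial>lborel) = mass (\<lambda>t. ennreal_powr (g t) r) c d"
        unfolding mass_def by (intro nn_integral_cong) (auto simp: indicator_def)
      also have "\<dots> \<le> ennreal (B powr r * (d - c) powr (1 - r)) * ennreal_powr (mass g c d) r"
        by (rule rh[OF cd])
      also have "\<dots> = ennreal (B powr r * (d - c) powr (1 - r) * t powr r)"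
        using t by (simp add: ennreal_mult)
      finally show "(\<integral>\<^sup>+x. ennreal_powr (?h x) r \<partial>lborel) \<le> \<dots>" .
    qed (use T t in auto)
    then show ?thesis unfolding t(1) using t(2)
      by (intro divide_le_posI_ennreal) (auto simp: mult.commute)
  qed
  then show "(case z of (a, b) \<Rightarrow> (\<integral>\<^sup>+x\<in>{a..b}. interval_maximal (\<lambda>t. g t * indicator {a..b} t) x \<partial>lborel) /
      mass g a b) \<le> ennreal (32 * (r / (r - 1)) * (1 + ln B))"
    by (simp only: z prod.case)
qed

text \<open>
  A real interval is approximated by rational ones from outside, so that the left-hand side only
  grows and the right-hand side converges.
\<close>
lemma reverse_hoelder_rational_to_real:
  assumes g[measurable]: "g \<in> borel_measurable borel" and r: "1 < r" and k: "0 \<le> k"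
    and fin: "\<And>p q. p \<in> \<rat> \<Longrightarrow> q \<in> \<rat> \<Longrightarrow> p < q \<Longrightarrow> mass g p q < top"
    and rh: "\<And>p q. p \<in> \<rat> \<Longrightarrow> q \<in> \<rat> \<Longrightarrow> p < q \<Longrightarrow> mass (\<lambda>t. ennreal_powr (g t) r) p q \<le>
      ennreal (k * (q - p) powr (1 - r)) * ennreal_powr (mass g p q) r"
    and cd: "c < d"
  shows "mass g c d < top \<and> mass (\<lambda>t. ennreal_powr (g t) r) c d \<le>
      ennreal (k * (d - c) powr (1 - r)) * ennreal_powr (mass g c d) r"
proof -
  have fin': "mass g a b < top" for a b by (rule mass_finite_if_rational[OF fin])
  have "\<exists>p\<in>\<rat>. c - 1 / real (Suc n) < p \<and> p < c" for n
    by (intro Rats_dense_in_real) auto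
  then obtain p where p: "\<And>n. p n \<in> \<rat>" "\<And>n. c - 1 / real (Suc n) < p n" "\<And>n. p n < c" by metis
  have "\<exists>q\<in>\<rat>. d < q \<and> q < d + 1 / real (Suc n)" for n
    by (intro Rats_dense_in_real) auto
  then obtain q where q: "\<And>n. q n \<in> \<rat>" "\<And>n. q n < d + 1 / real (Suc n)" "\<And>n. d < q n" by metis
  have pc: "p \<longlonglongrightarrow> c"
  proof (rule tendsto_sandwich[where f = "\<lambda>n. c - 1 / real (Suc n)" and h = "\<lambda>_. c"])
    have "(\<lambda>n. c - 1 / real (Suc n)) \<longlonglongrightarrow> c - 0"
      by (intro tendsto_intros LIMSEQ_inverse_real_of_nat[unfolded inverse_eq_divide])
    then show "(\<lambda>n. c - 1 / real (Suc n)) \<longlonglongrightarrow> c" by simp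
  qed (use p in \<open>auto intro!: always_eventually less_imp_le\<close>)
  have qd: "q \<longlonglongrightarrow> d"
  proof (rule tendsto_sandwich[where f = "\<lambda>_. d" and h = "\<lambda>n. d + 1 / real (Suc n)"])
    have "(\<lambda>n. d + 1 / real (Suc n)) \<longlonglongrightarrow> d + 0"
      by (intro tendsto_intros LIMSEQ_inverse_real_of_nat[unfolded inverse_eq_divide])
    then show "(\<lambda>n. d + 1 / real (Suc n)) \<longlonglongrightarrow> d" by simp
  qed (use q in \<open>auto intro!: always_eventually less_imp_le\<close>)
  have pq: "c - 1 \<le> p n \<and> q n \<le> d + 1 \<and> p n < c \<and> d < q n" for n
  proof -
    have "1 / real (Suc n) \<le> 1" by simp
    then show ?thesis using p(2,3)[of n] q(2,3)[of n] by linarith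
  qed
  have lim: "(\<lambda>n. mass g (p n) (q n)) \<longlonglongrightarrow> mass g c d"
    unfolding mass_def
  proof (rule nn_integral_dominated_convergence[where w = "\<lambda>x. g x * indicator {c - 1..d + 1} x"])
    show "(\<integral>\<^sup>+x\<in>{c - 1..d + 1}. g x \<partial>lborel) < \<infinity>"
      using fin'[of "c - 1" "d + 1"] by (simp add: mass_def)
    show "AE x in lborel. g x * indicator {p j..q j} x \<le> g x * indicator {c - 1..d + 1} x" for j
      using pq[of j] by (intro AE_I2) (auto simp: indicator_def)
    show "AE x in lborel. (\<lambda>n. g x * indicator {p n..q n} x) \<longlonglongrightarrow> g x * indicator {c..d} x"
    proof (rule AE_I2)
      fix x
      have "\<forall>\<^sub>F n in sequentially. x \<in> {p n..q n} \<longleftrightarrow> x \<in> {c..d}"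
      proof -
        consider "x < c" | "d < x" | "x \<in> {c..d}" by fastforce
        then show ?thesis
        proof cases
          case 1
          have "\<forall>\<^sub>F n in sequentially. x < p n" by (rule order_tendstoD(1)[OF pc 1])
          then show ?thesis by eventually_elim (use 1 in auto)
        next
          case 2
          have "\<forall>\<^sub>F n in sequentially. q n < x" by (rule order_tendstoD(2)[OF qd 2])
          then show ?thesis by eventually_elim (use 2 in auto)
        next
          case 3
          then show ?thesis using pq by (intro always_eventually allI) (meson atLeastAtMost_iff less_imp_le order_trans)
        qed
      qed
      then have "\<forall>\<^sub>F n in sequentially. g x * indicator {c..d} x = g x * indicator {p n..q n} x"
        by eventually_elim (auto simp: indicator_def)
      then show "(\<lambda>n. g x * indicator {p n..q n} x) \<longlonglongrightarrow> g x * indicator {c..d} x"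
        by (rule Lim_transform_eventually[OF tendsto_const])
    qed
  qed measurable
  define y where "y = (\<lambda>n. enn2real (mass g (p n) (q n)))"
  define Y where "Y = enn2real (mass g c d)"
  have y: "mass g (p n) (q n) = ennreal (y n)" for n using fin'[of "p n" "q n"] by (simp add: y_def less_top)
  have Y: "mass g c d = ennreal Y" using fin'[of c d] by (simp add: Y_def less_top)
  have yY: "y \<longlonglongrightarrow> Y" using lim unfolding y_def Y_def by (intro tendsto_enn2real) (auto simp: Y)
  define X where "X = enn2real (mass (\<lambda>t. ennreal_powr (g t) r) c d)"
  have b: "mass (\<lambda>t. ennreal_powr (g t) r) c d \<le> ennreal (k * (q n - p n) powr (1 - r) * y n powr r)" for n
  proof -
    have "mass (\<lambda>t. ennreal_powr (g t) r) c d \<le> mass (\<lambda>t. ennreal_powr (g t) r) (p n) (q n)"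
      using pq[of n] by (intro mass_mono) auto
    also have "\<dots> \<le> ennreal (k * (q n - p n) powr (1 - r)) * ennreal_powr (mass g (p n) (q n)) r"
      using pq[of n] cd by (intro rh p q) auto
    also have "\<dots> = ennreal (k * (q n - p n) powr (1 - r) * y n powr r)"
      unfolding y using k by (simp add: y_def ennreal_mult)
    finally show ?thesis .
  qed
  have X: "mass (\<lambda>t. ennreal_powr (g t) r) c d = ennreal X"
    using b[of 0] by (auto simp: X_def less_top[symmetric] top_unique intro!: ennreal_enn2real[symmetric])
  have "X \<le> k * (q n - p n) powr (1 - r) * y n powr r" for n
    using b[of n] k unfolding X by (subst (asm) ennreal_le_iff) auto
  moreover have "(\<lambda>n. k * (q n - p n) powr (1 - r) * y n powr r) \<longlonglongrightarrow> k * (d - c) powr (1 - r) * Y powr r"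
    using r cd by (intro tendsto_mult tendsto_const tendsto_powr tendsto_powr'[OF yY] tendsto_diff pc qd)
      (auto simp: y_def)
  ultimately have "X \<le> k * (d - c) powr (1 - r) * Y powr r"
    by (intro LIMSEQ_le_const) auto
  then have "ennreal X \<le> ennreal (k * (d - c) powr (1 - r) * Y powr r)" by (rule ennreal_leI)
  then show ?thesis using fin'[of c d] k unfolding X Y by (simp add: Y_def ennreal_mult)
qed

section \<open>Weights and their restrictions to lines\<close>

lemma box_on_lborel_on:
  assumes "finite I" "\<And>i. i \<in> I \<Longrightarrow> a i \<le> b i"
  shows "box_on I a b \<in> sets (lborel_on I)"
    "emeasure (lborel_on I) (box_on I a b) = ennreal (\<Prod>i\<in>I. b i - a i)"
    "measure (leb I) (box_on I a b) = (\<Prod>i\<in>I. b i - a i)"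
proof -
  show s: "box_on I a b \<in> sets (lborel_on I)" using assms by (intro sets_PiM_I_finite) auto
  show e: "emeasure (lborel_on I) (box_on I a b) = ennreal (\<Prod>i\<in>I. b i - a i)"
    using assms by (subst lborel_prod.emeasure_PiM) (auto simp: prod_ennreal)
  show "measure (leb I) (box_on I a b) = (\<Prod>i\<in>I. b i - a i)"
    using assms s e by (simp add: leb_def measure_def prod_nonneg)
qed

lemma weight_measurable:
  assumes "weight n w"
  shows "w \<in> borel_measurable (leb {1..n})"
proof (rule borel_measurable_LIMSEQ_metric)
  let ?R = "\<lambda>m. box_on {1..n} (\<lambda>_. - real (Suc m)) (\<lambda>_. real (Suc m))"
  fix m
  have "?R m \<in> parallelepipeds n" unfolding parallelepipeds_def by fastforce
  then have "integrable (leb {1..n}) (\<lambda>x. indicator (?R m) x *\<^sub>R w x)"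
    using assms by (simp add: weight_def set_integrable_def)
  then show "(\<lambda>x. indicator (?R m) x *\<^sub>R w x) \<in> borel_measurable (leb {1..n})" by auto
next
  let ?R = "\<lambda>m. box_on {1..n} (\<lambda>_. - real (Suc m)) (\<lambda>_. real (Suc m))"
  fix x assume x: "x \<in> space (leb {1..n})"
  then have ext: "x \<in> extensional {1..n}" by (simp add: leb_def space_PiM PiE_iff)
  obtain M :: nat where M: "(\<Sum>i\<in>{1..n}. \<bar>x i\<bar>) \<le> real M" using real_arch_simple by blast
  have "x \<in> ?R m" if "M \<le> m" for m
  proof -
    have abs: "\<bar>x i\<bar> \<le> real (Suc m)" if "i \<in> {1..n}" for i
    proof -
      have "\<bar>x i\<bar> \<le> (\<Sum>i\<in>{1..n}. \<bar>x i\<bar>)" using that by (intro member_le_sum) auto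
      then show ?thesis using M \<open>M \<le> m\<close> by simp
    qed
    have "x i \<in> {- real (Suc m)..real (Suc m)}" if "i \<in> {1..n}" for i
      using abs_le_D1[OF abs[OF that]] abs_le_D2[OF abs[OF that]]
      unfolding atLeastAtMost_iff by (intro conjI; linarith)
    then show ?thesis using ext by (simp only: PiE_iff) blast
  qed
  then have "\<forall>\<^sub>F m in sequentially. w x = indicator (?R m) x *\<^sub>R w x"
    by (intro eventually_sequentiallyI[of M]) (auto simp: indicator_def)
  then show "(\<lambda>m. indicator (?R m) x *\<^sub>R w x) \<longlonglongrightarrow> w x"
    by (rule Lim_transform_eventually[OF tendsto_const])
qed

lemma weight_borel_representative:
  assumes "weight n w"
  obtains f where "f \<in> borel_measurable (lborel_on {1..n})" "AE x in lborel_on {1..n}. ennreal (w x) = f x"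
proof -
  have "(\<lambda>x. ennreal (w x)) \<in> borel_measurable (completion (lborel_on {1..n}))"
    using weight_measurable[OF assms] by (simp add: leb_def)
  from completion_ex_borel_measurable[OF this] show ?thesis using that by blast
qed

lemma parallelepiped_integral:
  assumes w: "weight n w" and f: "AE x in lborel_on {1..n}. ennreal (w x) = f x"
    and R: "R \<in> parallelepipeds n"
  shows "(\<integral>\<^sup>+x\<in>R. f x \<partial>lborel_on {1..n}) = ennreal (LINT x:R|leb {1..n}. w x)"
    "0 \<le> (LINT x:R|leb {1..n}. w x)"
proof -
  have int: "integrable (leb {1..n}) (\<lambda>x. indicator R x *\<^sub>R w x)"
    using w R by (simp add: weight_def set_integrable_def)
  have nn: "AE x in leb {1..n}. 0 \<le> indicator R x *\<^sub>R w x"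
    using w by (intro AE_I2) (auto simp: weight_def)
  have "(\<integral>\<^sup>+x\<in>R. f x \<partial>lborel_on {1..n}) = (\<integral>\<^sup>+x. ennreal (indicator R x *\<^sub>R w x) \<partial>lborel_on {1..n})"
    using f by (intro nn_integral_cong_AE) (auto elim!: eventually_mono simp: indicator_def)
  also have "\<dots> = (\<integral>\<^sup>+x. ennreal (indicator R x *\<^sub>R w x) \<partial>leb {1..n})"
    by (simp add: leb_def nn_integral_completion)
  also have "\<dots> = ennreal (LINT x:R|leb {1..n}. w x)"
    unfolding set_lebesgue_integral_def by (rule nn_integral_eq_integral[OF int nn])
  finally show "(\<integral>\<^sup>+x\<in>R. f x \<partial>lborel_on {1..n}) = ennreal (LINT x:R|leb {1..n}. w x)" .
  show "0 \<le> (LINT x:R|leb {1..n}. w x)"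
    unfolding set_lebesgue_integral_def using nn by (rule integral_nonneg_AE)
qed

text \<open>
  The form to which Tonelli's theorem applies: the integrability of $w^r$ becomes finiteness of the
  left-hand side, which the inequality contains.
\<close>
lemma reverse_hoelder_iff:
  assumes w: "weight n w" and f: "AE x in lborel_on {1..n}. ennreal (w x) = f x"
    and ab: "\<And>i. i \<in> {1..n} \<Longrightarrow> a i < b i" and r: "1 < r" and K: "0 \<le> K"
  defines "R \<equiv> box_on {1..n} a b"
  shows "reverse_hoelder n r K w R \<longleftrightarrow>
    (\<integral>\<^sup>+x\<in>R. ennreal_powr (f x) r \<partial>lborel_on {1..n}) \<le>
      ennreal (K powr r * (\<Prod>i\<in>{1..n}. b i - a i) powr (1 - r)) *
      ennreal_powr (\<integral>\<^sup>+x\<in>R. f x \<partial>lborel_on {1..n}) r"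
proof -
  have R: "R \<in> parallelepipeds n" using ab unfolding R_def parallelepipeds_def by blast
  define m where "m = (\<Prod>i\<in>{1..n}. b i - a i)"
  have m: "0 < m" unfolding m_def using ab by (intro prod_pos) auto
  have meas: "measure (leb {1..n}) R = m"
    unfolding R_def m_def using ab by (intro box_on_lborel_on) (auto intro: less_imp_le)
  have Rs: "R \<in> sets (leb {1..n})"
    using box_on_lborel_on(1)[of "{1..n}" a b] ab by (auto simp: R_def leb_def less_imp_le)
  define Q where "Q = (LINT x:R|leb {1..n}. w x)"
  have Q: "(\<integral>\<^sup>+x\<in>R. f x \<partial>lborel_on {1..n}) = ennreal Q" "0 \<le> Q"
    using parallelepiped_integral[OF w f R] by (auto simp: Q_def)
  define P where "P = (LINT x:R|leb {1..n}. w x powr r)"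
  have nnw: "0 \<le> w x" if "x \<in> space (leb {1..n})" for x using w that by (auto simp: weight_def)
  have nnint: "(\<integral>\<^sup>+x\<in>R. ennreal_powr (f x) r \<partial>lborel_on {1..n}) =
      (\<integral>\<^sup>+x. ennreal (indicator R x *\<^sub>R (w x powr r)) \<partial>leb {1..n})"
  proof -
    have "AE x in lborel_on {1..n}. x \<in> space (lborel_on {1..n})" by (rule AE_space)
    with f have "AE x in lborel_on {1..n}. ennreal_powr (f x) r * indicator R x =
      ennreal (indicator R x *\<^sub>R (w x powr r))"
    proof eventually_elim
      case (elim x)
      have "0 \<le> w x" using nnw[of x] elim(2) by (simp add: leb_def)
      then show ?case using elim(1)[symmetric] by (auto simp: indicator_def)
    qed
    then have "(\<integral>\<^sup>+x\<in>R. ennreal_powr (f x) r \<partial>lborel_on {1..n}) =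
      (\<integral>\<^sup>+x. ennreal (indicator R x *\<^sub>R (w x powr r)) \<partial>lborel_on {1..n})"
      by (rule nn_integral_cong_AE)
    then show ?thesis by (simp add: leb_def nn_integral_completion)
  qed
  have wm: "(\<lambda>x. indicator R x *\<^sub>R (w x powr r)) \<in> borel_measurable (leb {1..n})"
    using Rs weight_measurable[OF w] by measurable
  have P0: "0 \<le> P" unfolding P_def set_lebesgue_integral_def by (intro integral_nonneg_AE AE_I2) auto
  have key: "(1 / m * P) powr (1 / r) \<le> K * (1 / m * Q) \<longleftrightarrow> P \<le> K powr r * m powr (1 - r) * Q powr r"
  proof -
    have iff: "X \<le> Y \<longleftrightarrow> X powr r \<le> Y powr r" if "0 \<le> X" "0 \<le> Y" for X Y :: real
      using that r powr_mono2[of r X Y] powr_less_mono2[of r Y X] by linarith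
    have "(1 / m * P) powr (1 / r) \<le> K * (1 / m * Q) \<longleftrightarrow>
        ((1 / m * P) powr (1 / r)) powr r \<le> (K * (1 / m * Q)) powr r"
      using r K Q(2) m by (intro iff) auto
    also have "((1 / m * P) powr (1 / r)) powr r = 1 / m * P"
      using r P0 m by (simp add: powr_powr)
    also have "(K * (1 / m * Q)) powr r = 1 / m * (K powr r * m powr (1 - r) * Q powr r)"
      using K Q m by (simp add: powr_mult powr_divide powr_diff)
    also have "1 / m * P \<le> 1 / m * (K powr r * m powr (1 - r) * Q powr r) \<longleftrightarrow>
        P \<le> K powr r * m powr (1 - r) * Q powr r"
      using m by (intro mult_le_cancel_left_pos) simp
    finally show ?thesis .
  qed
  have rhs: "ennreal (K powr r * m powr (1 - r)) * ennreal_powr (\<integral>\<^sup>+x\<in>R. f x \<partial>lborel_on {1..n}) r =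
      ennreal (K powr r * m powr (1 - r) * Q powr r)"
    unfolding Q(1) using Q(2) by (simp add: ennreal_mult)
  have lhs: "(\<integral>\<^sup>+x\<in>R. ennreal_powr (f x) r \<partial>lborel_on {1..n}) = ennreal P"
    if "set_integrable (leb {1..n}) R (\<lambda>x. w x powr r)"
    unfolding nnint P_def set_lebesgue_integral_def using that
    by (intro nn_integral_eq_integral) (auto simp: set_integrable_def)
  have rhdef: "reverse_hoelder n r K w R \<longleftrightarrow> set_integrable (leb {1..n}) R (\<lambda>x. w x powr r) \<and>
      (1 / m * P) powr (1 / r) \<le> K * (1 / m * Q)"
    unfolding reverse_hoelder_def average_def meas P_def Q_def ..
  show ?thesis unfolding rhdef key m_def[symmetric] rhs
  proof
    assume "set_integrable (leb {1..n}) R (\<lambda>x. w x powr r) \<and> P \<le> K powr r * m powr (1 - r) * Q powr r"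
    then show "(\<integral>\<^sup>+x\<in>R. ennreal_powr (f x) r \<partial>lborel_on {1..n}) \<le> ennreal (K powr r * m powr (1 - r) * Q powr r)"
      using lhs by (auto intro: ennreal_leI)
  next
    assume le: "(\<integral>\<^sup>+x\<in>R. ennreal_powr (f x) r \<partial>lborel_on {1..n}) \<le> ennreal (K powr r * m powr (1 - r) * Q powr r)"
    have int: "set_integrable (leb {1..n}) R (\<lambda>x. w x powr r)"
      unfolding set_integrable_def
    proof (rule integrableI_nonneg[OF wm])
      show "(\<integral>\<^sup>+x. ennreal (indicator R x *\<^sub>R (w x powr r)) \<partial>leb {1..n}) < \<infinity>"
        using le unfolding nnint by (auto intro: le_less_trans)
    qed auto
    then show "set_integrable (leb {1..n}) R (\<lambda>x. w x powr r) \<and> P \<le> K powr r * m powr (1 - r) * Q powr r"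
      using le lhs P0 by (simp add: ennreal_le_iff)
  qed
qed

text \<open>The infimum of the essential bounds is one of them: it is the infimum of countably many.\<close>
lemma AE_le_ess_sup: "AE x in M. f x \<le> ess_sup M f"
proof -
  have ne: "{z. AE x in M. f x \<le> z} \<noteq> {}" using top_greatest by blast
  obtain z :: "nat \<Rightarrow> ennreal" where z: "range z \<subseteq> {z. AE x in M. f x \<le> z}" "Inf {z. AE x in M. f x \<le> z} = (INF i. z i)"
    using ennreal_Inf_countable_INF[OF ne] by blast
  have "AE x in M. \<forall>i. f x \<le> z i"
    unfolding AE_all_countable using z(1) by blast
  then show ?thesis unfolding ess_sup_def z(2) by eventually_elim (auto intro: INF_greatest)
qed

lemma AE_lines:
  assumes w: "weight n w" and f: "AE x in lborel_on {1..n}. ennreal (w x) = f x" and j: "j \<in> {1..n}"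
  shows "AE x in lborel_on ({1..n} - {j}). x \<in> space (lborel_on ({1..n} - {j})) \<and>
    (\<forall>t. 0 \<le> w (x(j := t))) \<and> (AE t in lborel. ennreal (w (x(j := t))) = f (x(j := t)))"
proof -
  have ins: "insert j ({1..n} - {j}) = {1..n}" using j by auto
  have "AE x in lborel_on ({1..n} - {j}). AE t in lborel. ennreal (w (x(j := t))) = f (x(j := t))"
    using f by (intro AE_lborel_on_insertD) (simp_all only: ins, auto)
  moreover have "AE x in lborel_on ({1..n} - {j}). x \<in> space (lborel_on ({1..n} - {j}))" by (rule AE_space)
  ultimately show ?thesis
  proof eventually_elim
    case (elim x)
    have "x(j := t) \<in> space (lborel_on {1..n})" for t
      using measurable_space[OF measurable_update_lborel_on[OF elim(2), of j], of t] by (simp only: ins) simp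
    then have "0 \<le> w (x(j := t))" for t using w by (simp add: weight_def leb_def)
    with elim show ?case by blast
  qed
qed

section \<open>The two implications\<close>

theorem strong_A_infty_reverse_hoelder:
  assumes w: "w \<in> A_infty_star n" and R: "R \<in> parallelepipeds n" and r: "1 < r"
    and A: "enn2real (A_infty_star_const n w) < 1 \<or> 20 * enn2real (A_infty_star_const n w) * (r - 1) \<le> 1"
    and K: "6 ^ n \<le> K"
  shows "reverse_hoelder n r K w R"
proof -
  let ?I = "{1..n}"
  \<comment> \<open>\<open>fujii_wilson_imp_dyadic_A_infty\<close> needs a positive bound; 1/2 keeps it below 1 if it was.\<close>
  define A where "A = max (enn2real (A_infty_star_const n w)) (1 / 2)"
  have A0: "0 < A" "A < 1 \<or> 20 * A * (r - 1) \<le> 1"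
    using A r by (auto simp: A_def max_def)
  have wt: "weight n w" and fin: "A_infty_star_const n w < top" using w by (auto simp: A_infty_star_def)
  have cA: "A_infty_star_const n w \<le> ennreal A"
  proof -
    have "A_infty_star_const n w = ennreal (enn2real (A_infty_star_const n w))" using fin by simp
    also have "\<dots> \<le> ennreal A" by (intro ennreal_leI) (simp add: A_def)
    finally show ?thesis .
  qed
  obtain a b where ab: "R = box_on ?I a b" "\<And>i. i \<in> ?I \<Longrightarrow> a i < b i"
    using R unfolding parallelepipeds_def by blast
  obtain f where f: "f \<in> borel_measurable (lborel_on ?I)" "AE x in lborel_on ?I. ennreal (w x) = f x"
    using weight_borel_representative[OF wt] .
  have Rs: "R \<in> sets (lborel_on ?I)"
    unfolding ab(1) using ab(2) by (intro box_on_lborel_on) (auto intro: less_imp_le)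
  define g where "g = (\<lambda>x. f x * indicator R x)"
  have g: "g \<in> borel_measurable (lborel_on ?I)" unfolding g_def using f(1) Rs by measurable
  have box: "(\<integral>\<^sup>+x. ennreal_powr (g x) r \<partial>lborel_on ?I) \<le>
    ennreal (\<Prod>i\<in>?I. 6 * (b i - a i) powr (1 - r)) * ennreal_powr (\<integral>\<^sup>+x. g x \<partial>lborel_on ?I) r"
  proof (rule reverse_hoelder_box[OF _ g ab(2)])
    fix x i assume "g x \<noteq> 0" "i \<in> ?I"
    then show "x i \<in> {a i..b i}" unfolding g_def ab(1) by (auto simp: indicator_def PiE_iff split: if_splits)
  next
    fix j assume j: "j \<in> ?I"
    have ins: "insert j (?I - {j}) = ?I" using j by auto
    have "AE x in leb (?I - {j}). fujii_wilson (\<lambda>t. w (x(j := t))) \<le> ess_sup (leb (?I - {j})) (\<lambda>x. fujii_wilson (\<lambda>t. w (x(j := t))))"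
      by (rule AE_le_ess_sup)
    then have "AE x in lborel_on (?I - {j}). fujii_wilson (\<lambda>t. w (x(j := t))) \<le> ess_sup (leb (?I - {j})) (\<lambda>x. fujii_wilson (\<lambda>t. w (x(j := t))))"
      unfolding leb_def AE_completion_iff .
    then show "AE x in lborel_on (?I - {j}). dyadic_A_infty A (mass (\<lambda>t. g (x(j := t)))) (a j) (b j)"
      using AE_lines[OF wt f(2) j]
    proof eventually_elim
      case (elim x)
      have "ess_sup (leb (?I - {j})) (\<lambda>x. fujii_wilson (\<lambda>t. w (x(j := t)))) \<le> A_infty_star_const n w"
        unfolding A_infty_star_const_def using j by (intro SUP_upper)
      then have FW: "fujii_wilson (\<lambda>t. w (x(j := t))) \<le> ennreal A" using elim(1) cA by (meson order_trans)
      have line: "dyadic_A_infty A (mass (\<lambda>t. f (x(j := t)))) (a j) (b j)"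
        using elim(2) by (intro fujii_wilson_imp_dyadic_A_infty[OF _ _ FW A0(1)]) auto
      have xext: "x \<in> extensional (?I - {j})" using elim(2) by (simp add: space_PiM PiE_iff)
      show ?case
      proof (cases "x \<in> box_on (?I - {j}) a b")
        case True
        have mem: "x(j := t) \<in> R \<longleftrightarrow> t \<in> {a j..b j}" for t
          using True j unfolding ab(1) by (auto simp: PiE_iff extensional_def)
        show ?thesis
        proof (rule dyadic_A_infty_cong[OF _ line])
          fix p q assume pq: "a j \<le> p" "p < q" "q \<le> b j"
          show "mass (\<lambda>t. f (x(j := t))) p q = mass (\<lambda>t. g (x(j := t))) p q"
            unfolding mass_def using pq by (intro nn_integral_cong) (auto simp: indicator_def g_def mem)
        qed
      next
        case False
        have "x(j := t) \<notin> R" for t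
          using False xext j unfolding ab(1) by (auto simp: PiE_iff extensional_def split: if_splits)
        then have "mass (\<lambda>t. g (x(j := t))) = (\<lambda>_ _. 0)" by (intro ext) (simp add: mass_def g_def)
        then show ?thesis by (simp add: dyadic_A_infty_def dyadic_max_zero)
      qed
    qed
  qed (use A0 r in auto)
  have powr_g: "(\<integral>\<^sup>+x. ennreal_powr (g x) r \<partial>lborel_on ?I) = (\<integral>\<^sup>+x\<in>R. ennreal_powr (f x) r \<partial>lborel_on ?I)"
    unfolding g_def by (intro nn_integral_cong) (auto simp: indicator_def)
  have const: "ennreal (\<Prod>i\<in>?I. 6 * (b i - a i) powr (1 - r)) \<le>
      ennreal (K powr r * (\<Prod>i\<in>?I. b i - a i) powr (1 - r))"
  proof (rule ennreal_leI)
    have "(\<Prod>i\<in>?I. 6 * (b i - a i) powr (1 - r)) = 6 ^ n * (\<Prod>i\<in>?I. b i - a i) powr (1 - r)"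
      using ab(2) by (simp add: prod.distrib prod_powr_distrib less_imp_le)
    also have "\<dots> \<le> K powr r * (\<Prod>i\<in>?I. b i - a i) powr (1 - r)"
    proof (intro mult_right_mono)
      have "(1::real) \<le> 6 ^ n" by simp
      then have "1 \<le> K" using K by linarith
      then have "K powr 1 \<le> K powr r" using r by (intro powr_mono) auto
      then show "6 ^ n \<le> K powr r" using K \<open>1 \<le> K\<close> by simp
    qed simp
    finally show "(\<Prod>i\<in>?I. 6 * (b i - a i) powr (1 - r)) \<le> K powr r * (\<Prod>i\<in>?I. b i - a i) powr (1 - r)" .
  qed
  have "(\<integral>\<^sup>+x\<in>R. ennreal_powr (f x) r \<partial>lborel_on ?I) \<le>
      ennreal (K powr r * (\<Prod>i\<in>?I. b i - a i) powr (1 - r)) *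
      ennreal_powr (\<integral>\<^sup>+x\<in>R. f x \<partial>lborel_on ?I) r"
    using order_trans[OF box mult_right_mono[OF const]] unfolding powr_g by (simp add: g_def)
  moreover have "0 \<le> K" using K by (meson order_trans zero_le_numeral zero_le_power)
  ultimately show ?thesis unfolding ab(1)
    using reverse_hoelder_iff[where a = a and b = b, OF wt f(2) ab(2) r] by blast
qed

text \<open>
  For a fixed rational interval $[p,q]$ in the direction \<open>j\<close>, the integrals over that interval of $w$
  and $w^r$ are functions of the other coordinates to which \<open>AE_le_of_rational_boxes\<close> applies.
\<close>
theorem reverse_hoelder_strong_A_infty:
  assumes w: "weight n w" and r: "1 < r" "1 \<le> B"
    and rh: "\<And>R. R \<in> parallelepipeds n \<Longrightarrow> reverse_hoelder n r B w R"
  shows "A_infty_star_const n w \<le> ennreal (32 * (r / (r - 1)) * (1 + ln B))"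
  unfolding A_infty_star_const_def
proof (rule SUP_least)
  let ?I = "{1..n}" and ?C = "ennreal (32 * (r / (r - 1)) * (1 + ln B))"
  fix j assume j: "j \<in> ?I"
  let ?S = "?I - {j}"
  have ins: "insert j ?S = ?I" using j by auto
  have jS: "finite ?S" "j \<notin> ?S" by auto
  obtain f where f: "f \<in> borel_measurable (lborel_on ?I)" "AE x in lborel_on ?I. ennreal (w x) = f x"
    using weight_borel_representative[OF w] .
  have f': "f \<in> borel_measurable (lborel_on (insert j ?S))" using f(1) by (simp only: ins)
  have fr': "(\<lambda>x. ennreal_powr (f x) r) \<in> borel_measurable (lborel_on (insert j ?S))"
    by (rule measurable_ennreal_powr[OF f'])
  have "AE x in lborel_on ?S. \<forall>p\<in>\<rat>. \<forall>q\<in>\<rat>. p < q \<longrightarrow>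
      mass (\<lambda>t. ennreal_powr (f (x(j := t))) r) p q \<le> ennreal (B powr r * (q - p) powr (1 - r)) *
        ennreal_powr (mass (\<lambda>t. f (x(j := t))) p q) r \<and> mass (\<lambda>t. f (x(j := t))) p q < top"
  proof (intro AE_ball_countable[THEN iffD2] countable_rat ballI AE_impI)
    fix p q :: real assume pq: "p \<in> \<rat>" "q \<in> \<rat>" "p < q"
    show "AE x in lborel_on ?S. mass (\<lambda>t. ennreal_powr (f (x(j := t))) r) p q \<le> ennreal (B powr r * (q - p) powr (1 - r)) *
        ennreal_powr (mass (\<lambda>t. f (x(j := t))) p q) r \<and> mass (\<lambda>t. f (x(j := t))) p q < top"
    proof (rule AE_le_of_rational_boxes[OF jS(1) measurable_mass_line[OF fr'] measurable_mass_line[OF f'] _ r(1)])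
      fix a b :: "nat \<Rightarrow> real" assume ab: "\<forall>i\<in>?S. a i \<in> \<rat> \<and> b i \<in> \<rat> \<and> a i < b i"
      let ?a = "a(j := p)" and ?b = "b(j := q)"
      have lt: "?a i < ?b i" if "i \<in> ?I" for i using ab pq that by auto
      have box: "box_on ?S ?a ?b = box_on ?S a b" by (intro PiE_cong) auto
      have prod: "(\<Prod>i\<in>?I. ?b i - ?a i) = (q - p) * (\<Prod>i\<in>?S. b i - a i)"
      proof -
        have "(\<Prod>i\<in>?S. ?b i - ?a i) = (\<Prod>i\<in>?S. b i - a i)" by (intro prod.cong) auto
        then show ?thesis using j by (subst prod.remove[of _ j]) auto
      qed
      have "0 \<le> (\<Prod>i\<in>?S. b i - a i)" using ab by (intro prod_nonneg) (force intro: less_imp_le)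
      then have pw: "B powr r * (\<Prod>i\<in>?I. ?b i - ?a i) powr (1 - r) =
          B powr r * (q - p) powr (1 - r) * (\<Prod>i\<in>?S. b i - a i) powr (1 - r)"
        unfolding prod using pq by (simp add: powr_mult)
      have boxint: "(\<integral>\<^sup>+x\<in>box_on ?I ?a ?b. F x \<partial>lborel_on ?I) =
          (\<integral>\<^sup>+x\<in>box_on ?S a b. mass (\<lambda>t. F (x(j := t))) p q \<partial>lborel_on ?S)"
        if "F \<in> borel_measurable (lborel_on (insert j ?S))" for F
        using nn_integral_box_insert[OF jS that, of ?a ?b] unfolding box unfolding ins by simp
      have par: "box_on ?I ?a ?b \<in> parallelepipeds n" using lt unfolding parallelepipeds_def by blast
      have "(\<integral>\<^sup>+x\<in>box_on ?I ?a ?b. f x \<partial>lborel_on ?I) < top"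
        unfolding parallelepiped_integral(1)[OF w f(2) par] by simp
      moreover have "(\<integral>\<^sup>+x\<in>box_on ?I ?a ?b. ennreal_powr (f x) r \<partial>lborel_on ?I) \<le>
          ennreal (B powr r * (\<Prod>i\<in>?I. ?b i - ?a i) powr (1 - r)) *
          ennreal_powr (\<integral>\<^sup>+x\<in>box_on ?I ?a ?b. f x \<partial>lborel_on ?I) r"
        using rh[OF par] r by (subst (asm) reverse_hoelder_iff[where a = ?a and b = ?b, OF w f(2) lt]) auto
      ultimately show "(\<integral>\<^sup>+x\<in>box_on ?S a b. mass (\<lambda>t. f (x(j := t))) p q \<partial>lborel_on ?S) < top \<and>
        (\<integral>\<^sup>+x\<in>box_on ?S a b. mass (\<lambda>t. ennreal_powr (f (x(j := t))) r) p q \<partial>lborel_on ?S) \<le>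
        ennreal (B powr r * (q - p) powr (1 - r) * (\<Prod>i\<in>?S. b i - a i) powr (1 - r)) *
        ennreal_powr (\<integral>\<^sup>+x\<in>box_on ?S a b. mass (\<lambda>t. f (x(j := t))) p q \<partial>lborel_on ?S) r"
        unfolding boxint[OF f'] boxint[OF fr'] pw by blast
    qed simp
  qed
  then have "AE x in lborel_on ?S. fujii_wilson (\<lambda>t. w (x(j := t))) \<le> ?C"
    using AE_lines[OF w f(2) j]
  proof eventually_elim
    case (elim x)
    have g: "(\<lambda>t. f (x(j := t))) \<in> borel_measurable borel"
      using elim(2) by (intro measurable_line[OF f']) auto
    have line: "mass (\<lambda>t. f (x(j := t))) c d < top \<and> mass (\<lambda>t. ennreal_powr (f (x(j := t))) r) c d \<le>
      ennreal (B powr r * (d - c) powr (1 - r)) * ennreal_powr (mass (\<lambda>t. f (x(j := t))) c d) r"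
      if "c < d" for c d
      using elim(1) by (intro reverse_hoelder_rational_to_real[OF g r(1) _ _ _ that]) auto
    show ?case
      using elim(2) line by (intro fujii_wilson_le[OF _ _ g r]) auto
  qed
  then have "AE x in leb ?S. fujii_wilson (\<lambda>t. w (x(j := t))) \<le> ?C"
    unfolding leb_def AE_completion_iff .
  then show "ess_sup (leb ?S) (\<lambda>x. fujii_wilson (\<lambda>t. w (x(j := t)))) \<le> ?C"
    unfolding ess_sup_def by (intro Inf_lower) simp
qed

text \<open>
  The bound on \<open>r\<close> forces $40 n A > 1$ for the constant \<open>A\<close> of the weight. If $A \ge 1$, then
  $40 n A - 1 \ge 20 A$ and the reverse Hoelder inequality holds with the constant $6^n$; the
  denominator lies between 0 and 1.
\<close>
lemma reverse_hoelder_below_threshold: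
  fixes r :: real
  assumes n: "1 \<le> n" and w: "w \<in> A_infty_star n" and R: "R \<in> parallelepipeds n"
    and r: "1 < r" "r < 1 + 1 / (40 * real n * enn2real (A_infty_star_const n w) - 1)"
  shows "reverse_hoelder n r
    (6 ^ n / (1 - (r - 1) * (40 * real n * enn2real (A_infty_star_const n w) - 1)) powr (1 / r)) w R"
proof -
  define A where "A = enn2real (A_infty_star_const n w)"
  define s where "s = 40 * real n * A - 1"
  have rs: "r - 1 < 1 / s" using r(2) by (simp add: s_def A_def)
  then have "0 < 1 / s" using r(1) by linarith
  then have s: "0 < s" by simp
  have q: "0 < 1 - (r - 1) * s" "1 - (r - 1) * s \<le> 1"
    using r(1) rs s by (auto simp: field_simps)
  have "A < 1 \<or> 20 * A * (r - 1) \<le> 1"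
  proof (cases "A < 1")
    case False
    then have A: "1 \<le> A" by simp
    have "1 * A \<le> real n * A" using n A by (intro mult_right_mono) auto
    then have "20 * A \<le> s" using A unfolding s_def by linarith
    then have "20 * A * (r - 1) \<le> s * (r - 1)" using r(1) by (intro mult_right_mono) auto
    also have "\<dots> \<le> 1" using q by (simp add: mult.commute)
    finally show ?thesis by simp
  qed simp
  moreover have "6 ^ n \<le> 6 ^ n / (1 - (r - 1) * s) powr (1 / r)"
  proof -
    have "(1 - (r - 1) * s) powr (1 / r) \<le> 1" using q r(1) by (intro powr_le1) auto
    moreover have "0 < (1 - (r - 1) * s) powr (1 / r)" using q by simp
    ultimately show ?thesis by (simp add: field_simps)
  qed
  ultimately show ?thesis
    using strong_A_infty_reverse_hoelder[OF w R r(1)] unfolding s_def A_def by blast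
qed

lemma conjugate_exponent_eq:
  fixes r r' :: real
  assumes "1 < r" "1 / r + 1 / r' = 1"
  shows "r' = r / (r - 1)"
proof -
  have "1 / r' = 1 - 1 / r" using assms by linarith
  also have "\<dots> = (r - 1) / r" using assms by (simp add: diff_divide_distrib)
  finally have "1 / (1 / r') = 1 / ((r - 1) / r)" by (rule arg_cong)
  then show ?thesis by simp
qed

theorem theorem1p4:
  shows "\<exists>c::real. c > 0 \<and> (\<exists>C::real. C > 0 \<and> (\<forall>n::nat. n \<ge> 1 \<longrightarrow> (\<exists>Cn::real. Cn > 0 \<and>
    (\<forall>w\<in>A_infty_star n. \<forall>R\<in>parallelepipeds n. \<forall>r::real.
       1 < r \<and> r < 1 + 1 / (c * real n * enn2real (A_infty_star_const n w) - 1) \<longrightarrow>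
       reverse_hoelder n r
         (Cn / (1 - (r - 1) * (c * real n * enn2real (A_infty_star_const n w) - 1)) powr (1 / r))
         w R) \<and>
    (\<forall>(r::real) (r'::real) (B::real) w.
       r > 1 \<and> 1 / r + 1 / r' = 1 \<and> B \<ge> 1 \<and> weight n w \<and>
       (\<forall>R\<in>parallelepipeds n. reverse_hoelder n r B w R) \<longrightarrow>
       w \<in> A_infty_star n \<and>
       A_infty_star_const n w \<le> ennreal (C * r' * (1 + ln B))))))"
proof (rule exI[of _ 40], rule conjI, simp, rule exI[of _ 32], rule conjI, simp, intro allI impI,
    rule exI[of _ "6 ^ n" for n], intro conjI ballI allI impI)
  fix n w R and r :: real
  assume "1 \<le> n" "w \<in> A_infty_star n" "R \<in> parallelepipeds n"
    "1 < r \<and> r < 1 + 1 / (40 * real n * enn2real (A_infty_star_const n w) - 1)"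
  then show "reverse_hoelder n r
    (6 ^ n / (1 - (r - 1) * (40 * real n * enn2real (A_infty_star_const n w) - 1)) powr (1 / r)) w R"
    by (intro reverse_hoelder_below_threshold) auto
next
  fix n w and r r' B :: real
  assume *: "r > 1 \<and> 1 / r + 1 / r' = 1 \<and> B \<ge> 1 \<and> weight n w \<and>
    (\<forall>R\<in>parallelepipeds n. reverse_hoelder n r B w R)"
  then have "r' = r / (r - 1)" by (intro conjugate_exponent_eq) auto
  then show "A_infty_star_const n w \<le> ennreal (32 * r' * (1 + ln B))"
    using reverse_hoelder_strong_A_infty[of n w r B] * by simp
  then have "A_infty_star_const n w < top" by (rule le_less_trans) simp
  then show "w \<in> A_infty_star n" using * by (simp add: A_infty_star_def)
qed simp

end
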